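(* Let $T>0$. Assume that the control system $\dot u^c(t)=Au^c(t)+Bv(t)$, $t\ge 0$, $u^c(0)=x$, is (exactly) null controllable in time $T$. Assume that the Lévy measure $\nu$ has a density $k$ with respect to Lebesgue measure on $\mathbb{R}$ and that there exist an index $\alpha\in(1,2]$ and constants $K_0>0$, $r_0>0$ such that $k(r)=K_0|r|^{-\alpha-1}$ for all $0<|r|\le r_0$. For $x\in H$ let $u(\cdot,x)$ be the solution of $$du(t,x)=Au(t,x)\,dt+\int_{\mathbb{R}}B\,z\,\tilde\eta(dz,dt),\qquad u(0,x)=x .$$ Then for all $C>0$, for all $x\in\mathcal{D}_H(C)$ and all $\delta>0$ there exists $\kappa>0$ such that $$\mathbb{P}\big(u(T,x)\in \mathcal{D}_H(\delta)\big)\ge\kappa .$$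
   Context: $H$ is a Hilbert space and $A$ is the generator of a strongly continuous semigroup on $H$; following the paper this semigroup is denoted $(e^{-tA})_{t\ge0}$. $B:\mathbb{R}\to D(A^{-\gamma})$ is a bounded linear operator for some $\gamma<\tfrac12$, where $D(A^{-\gamma})$ is the extrapolation space of $A$, i.e. the completion of $H$ under the norm $|(\lambda-A)^{-\gamma}\cdot|_H$ for $\lambda$ with sufficiently large real part; the semigroup is extended to this space. $\mathcal{D}_H(C):=\{z\in H:|z|\le C\}$ for $C>0$. Noise: $(\Omega,\mathcal F,(\mathcal F_t)_{t\ge0},\mathbb P)$ is a complete filtered probability space with right-continuous filtration; $\eta$ is a time-homogeneous Poisson random measure on $\mathbb{R}$ over it, with intensity $\nu$, a Lévy measure on $\mathbb{R}$ ($\nu(\{0\})=0$, $\int(|z|^2\wedge1)\,\nu(dz)<\infty$) and compensator $\gamma(A\times I)=\nu(A)\lambda(I)$ ($\lambda$ = Lebesgue measure); $\tilde\eta$ is the compensated measure. Solutions are understood in the mild sense: $u(t,x)=e^{-tA}x+\int_0^t\int_{\mathbb R}e^{-(t-s)A}Bz\,\tilde\eta(dz,ds)$ in $H$. Control: for $x\in H$ and $v\in L^2([0,T];\mathbb{R})$, $u^c(\cdot,x,v)$ is the mild solution of $\dot u^c=Au^c+Bv$, $u^c(0,x,v)=x$. The system is null controllable in time $T$ if for any $x\in H$ there is $v\in L^2([0,T];\mathbb{R})$ with $u^c(T,x,v)=0$. *)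

theory Defs
  imports "HOL-Probability.Probability"
begin

section \<open>Semigroups, generators and extrapolation spaces\<close>

definition C0_semigroup :: "(real \<Rightarrow> 'a::real_normed_vector \<Rightarrow> 'a) \<Rightarrow> bool" where
  "C0_semigroup S \<longleftrightarrow>
     (\<forall>t\<ge>0. bounded_linear (S t)) \<and>
     (\<forall>x. S 0 x = x) \<and>
     (\<forall>s\<ge>0. \<forall>t\<ge>0. \<forall>x. S (s + t) x = S s (S t x)) \<and>
     (\<forall>x. ((\<lambda>t. S t x) \<longlongrightarrow> x) (at_right 0))"

text \<open>The unbounded operator \<open>A\<close> with domain \<open>D\<close> is the generator of \<open>S\<close>; values of \<open>A\<close>
  outside \<open>D\<close> are irrelevant. With the sign convention \<open>u' = A u\<close> used here, the semigroup
  generated by \<open>A\<close> is the family written $e^{-tA}$ in the mild formulas below.\<close>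

definition generates :: "'a set \<Rightarrow> ('a::real_normed_vector \<Rightarrow> 'a) \<Rightarrow> (real \<Rightarrow> 'a \<Rightarrow> 'a) \<Rightarrow> bool" where
  "generates D A S \<longleftrightarrow>
     C0_semigroup S \<and>
     D = {x. \<exists>y. ((\<lambda>h. (1 / h) *\<^sub>R (S h x - x)) \<longlongrightarrow> y) (at_right 0)} \<and>
     (\<forall>x\<in>D. ((\<lambda>h. (1 / h) *\<^sub>R (S h x - x)) \<longlongrightarrow> A x) (at_right 0))"

definition growth_bound_below :: "(real \<Rightarrow> 'a::real_normed_vector \<Rightarrow> 'a) \<Rightarrow> real \<Rightarrow> bool" where
  "growth_bound_below S lam \<longleftrightarrow>
     (\<exists>M w. w < lam \<and> (\<forall>t\<ge>0. \<forall>x. norm (S t x) \<le> M * exp (w * t) * norm x))"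

text \<open>The negative fractional power $(\lambda - A)^{-\gamma}$ for $\gamma \ge 0$ and $\lambda$ above
  the growth bound, given by the usual formula
  $\Gamma(\gamma)^{-1} \int_0^\infty t^{\gamma-1} e^{-\lambda t} S(t) x \, dt$.\<close>

definition neg_frac_power :: "(real \<Rightarrow> 'a::banach \<Rightarrow> 'a) \<Rightarrow> real \<Rightarrow> real \<Rightarrow> 'a \<Rightarrow> 'a" where
  "neg_frac_power S lam \<gamma> x =
     (if \<gamma> = 0 then x
      else (1 / Gamma \<gamma>) *\<^sub>R
             integral {0..} (\<lambda>t. (t powr (\<gamma> - 1) * exp (- lam * t)) *\<^sub>R S t x))"

text \<open>\<open>\<iota>\<close> exhibits the complete space \<open>'e\<close> as the completion of \<open>'h\<close> under the norm
  $|(\lambda - A)^{-\gamma} \cdot|$. The completion is unique up to isometric isomorphism, so a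
  statement about all such \<open>\<iota>\<close> is a statement about the extrapolation space.\<close>

definition extrapolation_space ::
  "(real \<Rightarrow> 'h::banach \<Rightarrow> 'h) \<Rightarrow> real \<Rightarrow> real \<Rightarrow> ('h \<Rightarrow> 'e::banach) \<Rightarrow> bool" where
  "extrapolation_space S lam \<gamma> \<iota> \<longleftrightarrow>
     linear \<iota> \<and> inj \<iota> \<and>
     (\<forall>x. norm (\<iota> x) = norm (neg_frac_power S lam \<gamma> x)) \<and>
     closure (range \<iota>) = UNIV"

definition extends_semigroup ::
  "('h \<Rightarrow> 'e) \<Rightarrow> (real \<Rightarrow> 'h \<Rightarrow> 'h) \<Rightarrow> (real \<Rightarrow> 'e::real_normed_vector \<Rightarrow> 'e) \<Rightarrow> bool" where
  "extends_semigroup \<iota> S SE \<longleftrightarrow>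
     (\<forall>t\<ge>0. bounded_linear (SE t) \<and> (\<forall>x. SE t (\<iota> x) = \<iota> (S t x)))"


section \<open>The control system\<close>

definition L2_fun :: "real \<Rightarrow> (real \<Rightarrow> real) \<Rightarrow> bool" where
  "L2_fun T v \<longleftrightarrow>
     v \<in> borel_measurable (lebesgue_on {0..T}) \<and>
     integrable (lebesgue_on {0..T}) (\<lambda>s. (v s)\<^sup>2)"

text \<open>Mild solution of \<open>w' = A w + B v\<close>, \<open>w 0 = x\<close> on \<open>{0..T}\<close>. Since \<open>B\<close> takes values in the
  extrapolation space, the variation of constants formula is an identity in that space.\<close>

definition mild_control_solution ::
  "(real \<Rightarrow> 'h \<Rightarrow> 'h) \<Rightarrow> ('h \<Rightarrow> 'e::banach) \<Rightarrow> (real \<Rightarrow> 'e \<Rightarrow> 'e) \<Rightarrow> (real \<Rightarrow> 'e) \<Rightarrow>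
   real \<Rightarrow> 'h \<Rightarrow> (real \<Rightarrow> real) \<Rightarrow> (real \<Rightarrow> 'e) \<Rightarrow> bool" where
  "mild_control_solution S \<iota> SE B T x v w \<longleftrightarrow>
     (\<forall>t\<in>{0..T}. ((\<lambda>s. SE (t - s) (B (v s))) has_integral (w t - \<iota> (S t x))) {0..t})"

definition null_controllable ::
  "(real \<Rightarrow> 'h \<Rightarrow> 'h) \<Rightarrow> ('h \<Rightarrow> 'e::banach) \<Rightarrow> (real \<Rightarrow> 'e \<Rightarrow> 'e) \<Rightarrow> (real \<Rightarrow> 'e) \<Rightarrow>
   real \<Rightarrow> bool" where
  "null_controllable S \<iota> SE B T \<longleftrightarrow>
     (\<forall>x. \<exists>v w. L2_fun T v \<and> mild_control_solution S \<iota> SE B T x v w \<and> w T = 0)"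


section \<open>Poisson random measures\<close>

definition usual_filtration :: "'w measure \<Rightarrow> (real \<Rightarrow> 'w measure) \<Rightarrow> bool" where
  "usual_filtration P F \<longleftrightarrow>
     prob_space P \<and> complete_measure P \<and>
     (\<forall>t\<ge>0. subalgebra P (F t)) \<and>
     (\<forall>s\<ge>0. \<forall>t\<ge>s. sets (F s) \<subseteq> sets (F t)) \<and>
     null_sets P \<subseteq> sets (F 0) \<and>
     (\<forall>t\<ge>0. sets (F t) = (\<Inter>s\<in>{t<..}. sets (F s)))"

definition levy_measure :: "real measure \<Rightarrow> bool" where
  "levy_measure \<nu> \<longleftrightarrow>
     sets \<nu> = sets borel \<and> emeasure \<nu> {0} = 0 \<and>
     (\<integral>\<^sup>+z. ennreal (min (z\<^sup>2) 1) \<partial>\<nu>) < \<infinity>"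

text \<open>Points are pairs (jump size, time), and times are nonnegative.\<close>

definition compensator :: "real measure \<Rightarrow> (real \<times> real) measure" where
  "compensator \<nu> = \<nu> \<Otimes>\<^sub>M restrict_space lborel {0..}"

definition poisson_random_measure ::
  "'w measure \<Rightarrow> (real \<Rightarrow> 'w measure) \<Rightarrow> real measure \<Rightarrow> ('w \<Rightarrow> (real \<times> real) measure) \<Rightarrow> bool" where
  "poisson_random_measure P F \<nu> \<eta> \<longleftrightarrow>
     (\<forall>\<omega>\<in>space P. sets (\<eta> \<omega>) = sets (compensator \<nu>) \<and>
        (\<forall>U\<in>sets (compensator \<nu>). emeasure (\<eta> \<omega>) U \<in> range ennreal_of_enat)) \<and>
     (\<forall>U\<in>sets (compensator \<nu>). (\<lambda>\<omega>. emeasure (\<eta> \<omega>) U) \<in> borel_measurable P) \<and>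
     (\<forall>U\<in>sets (compensator \<nu>). emeasure (compensator \<nu>) U < \<infinity> \<longrightarrow>
        (\<forall>n. measure P {\<omega>\<in>space P. emeasure (\<eta> \<omega>) U = of_nat n} =
               exp (- measure (compensator \<nu>) U) * measure (compensator \<nu>) U ^ n / fact n)) \<and>
     (\<forall>U\<in>sets (compensator \<nu>). emeasure (compensator \<nu>) U = \<infinity> \<longrightarrow>
        (AE \<omega> in P. emeasure (\<eta> \<omega>) U = \<infinity>)) \<and>
     (\<forall>(n::nat) U. (\<forall>i<n. U i \<in> sets (compensator \<nu>)) \<longrightarrow> disjoint_family_on U {..<n} \<longrightarrow>
        prob_space.indep_vars P (\<lambda>_. borel) (\<lambda>i \<omega>. emeasure (\<eta> \<omega>) (U i)) {..<n}) \<and>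
     (\<forall>t\<ge>0. \<forall>U\<in>sets (compensator \<nu>). U \<subseteq> UNIV \<times> {0..t} \<longrightarrow>
        (\<lambda>\<omega>. emeasure (\<eta> \<omega>) U) \<in> borel_measurable (F t)) \<and>
     (\<forall>s\<ge>0. prob_space.indep_set P (sets (F s))
        (sigma_sets (space P)
           {{\<omega>\<in>space P. emeasure (\<eta> \<omega>) U \<in> X} | U X.
              U \<in> sets (compensator \<nu>) \<and> U \<subseteq> UNIV \<times> {s<..} \<and> X \<in> sets borel}))"


section \<open>Integrals against the compensated measure\<close>

text \<open>The Bochner integral. This is the definition of the library's \<open>has_bochner_integral\<close>, which
  is restricted to second countable spaces; no separability of the Hilbert space is assumed
  here.\<close>

definition bochner :: "'a measure \<Rightarrow> ('a \<Rightarrow> 'b::real_normed_vector) \<Rightarrow> 'b \<Rightarrow> bool" where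
  "bochner M f y \<longleftrightarrow>
     f \<in> borel_measurable M \<and>
     (\<exists>s. (\<forall>i. Bochner_Integration.simple_bochner_integrable M (s i)) \<and>
          (\<lambda>i. \<integral>\<^sup>+x. ennreal (norm (f x - s i x)) \<partial>M) \<longlonglongrightarrow> 0 \<and>
          (\<lambda>i. Bochner_Integration.simple_bochner_integral M (s i)) \<longlonglongrightarrow> y)"

definition jumps_above :: "real \<Rightarrow> real \<Rightarrow> (real \<times> real) set" where
  "jumps_above \<epsilon> t = {(z, s). \<epsilon> < \<bar>z\<bar> \<and> 0 < s \<and> s \<le> t}"

text \<open>\<open>Z\<close> is (a version of) $\int_0^t \int_{\mathbb R} \Phi(z,s)\, \tilde\eta(dz,ds)$ for deterministic
  \<open>\<Phi>\<close>: the limit in probability, as $\varepsilon \to 0$, of the integrals over the jumps larger than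
  $\varepsilon$, for which $\eta$ is almost surely finite on bounded time intervals and
  $\tilde\eta = \eta - \nu \otimes \lambda$ can be integrated pathwise. All jumps are compensated,
  so the existence of this integral includes integrability of \<open>\<Phi>\<close> over the large jumps. When
  $\Phi$ is in $L^2(\nu \otimes \lambda)$ this is the usual isometric integral.\<close>

definition has_compensated_integral ::
  "'w measure \<Rightarrow> real measure \<Rightarrow> ('w \<Rightarrow> (real \<times> real) measure) \<Rightarrow> real \<Rightarrow>
   (real \<times> real \<Rightarrow> 'b::real_normed_vector) \<Rightarrow> ('w \<Rightarrow> 'b) \<Rightarrow> bool" where
  "has_compensated_integral P \<nu> \<eta> t \<Phi> Z \<longleftrightarrow>
     (\<exists>J c. (\<forall>\<epsilon>>0.
               bochner (restrict_space (compensator \<nu>) (jumps_above \<epsilon> t)) \<Phi> (c \<epsilon>) \<and>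
               (AE \<omega> in P. bochner (restrict_space (\<eta> \<omega>) (jumps_above \<epsilon> t)) \<Phi> (J \<epsilon> \<omega> + c \<epsilon>)) \<and>
               (\<lambda>\<omega>. norm (J \<epsilon> \<omega> - Z \<omega>)) \<in> borel_measurable P) \<and>
            (\<forall>a>0. ((\<lambda>\<epsilon>. measure P {\<omega>\<in>space P. a < norm (J \<epsilon> \<omega> - Z \<omega>)}) \<longlongrightarrow> 0)
               (at_right 0)))"

text \<open>The mild formula is an identity in \<open>'h\<close>: up to null sets the integrand
  $e^{-(t-s)A} B z$, formed in the extrapolation space, is the image of an \<open>'h\<close>-valued \<open>\<Phi>\<close>.\<close>

definition mild_solution ::
  "'w measure \<Rightarrow> (real \<Rightarrow> 'w measure) \<Rightarrow> real measure \<Rightarrow> ('w \<Rightarrow> (real \<times> real) measure) \<Rightarrow>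
   (real \<Rightarrow> 'h \<Rightarrow> 'h) \<Rightarrow> ('h::real_normed_vector \<Rightarrow> 'e) \<Rightarrow> (real \<Rightarrow> 'e \<Rightarrow> 'e) \<Rightarrow> (real \<Rightarrow> 'e) \<Rightarrow>
   'h \<Rightarrow> (real \<Rightarrow> 'w \<Rightarrow> 'h) \<Rightarrow> bool" where
  "mild_solution P F \<nu> \<eta> S \<iota> SE B x u \<longleftrightarrow>
     (\<forall>t\<ge>0. u t \<in> borel_measurable (F t) \<and>
        (\<exists>\<Phi> Z. (AE (z, s) in compensator \<nu>. 0 < s \<and> s \<le> t \<longrightarrow> \<iota> (\<Phi> (z, s)) = SE (t - s) (B z)) \<and>
               has_compensated_integral P \<nu> \<eta> t \<Phi> Z \<and>
               (AE \<omega> in P. u t \<omega> = S t x + Z \<omega>)))"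

end

theory Submission
  imports Defs
begin

text \<open>Put \<open>b r = e\<^bsup>-rA\<^esup> B 1\<close>. The existence of the mild solution forces \<open>b r\<close> into \<open>H\<close> for every
  \<open>r > 0\<close>, and a jump of size \<open>z\<close> at time \<open>s\<close> contributes \<open>z b(T - s)\<close> to \<open>u(T, x)\<close>. Null
  controllability puts \<open>- e\<^bsup>-TA\<^esup> x\<close> into the closed span of \<open>b r\<close>, \<open>0 < r < T\<close>, and the compensator
  \<open>c\<close> of the jumps larger than \<open>\<epsilon>\<close> lies there too. Since the jump density is positive near \<open>0\<close> on both
  sides, differences of jump sizes in \<open>(\<epsilon>, r0)\<close> produce arbitrary real coefficients, so
  \<open>c - e\<^bsup>-TA\<^esup> x\<close> is approximated by the contribution of some finite configuration of jumps
  larger than \<open>\<epsilon>\<close>; configurations close to it have positive probability. The jumps smaller than \<open>\<epsilon>\<close>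
  are independent of them and, for small \<open>\<epsilon>\<close>, contribute little with probability at least one half.\<close>

subsection \<open>Bochner integrals in spaces without a countable base\<close>

text \<open>Two obstacles shape the argument. The Hilbert space need not be separable, so sums of
  measurable \<open>'h\<close>-valued maps need not be measurable; probabilistic statements are
  reduced to numbers of jumps in finitely many cells and to real functions of these. Moreover,
  independence of small and large jumps is available only through counts of disjoint sets, whereas
  the small-jump remainder \<open>J \<epsilon> - Z\<close> is tied to the jumps by a limit in
  probability. It is replaced by \<open>J \<epsilon> - J \<epsilon>'\<close> for a second threshold
  \<epsilon>' < \<epsilon>, whose norm is close, outside an event of small probability, to a
  function of counts of cells disjoint from the jumps above \<epsilon>. The order of choices
  matters: \<epsilon> is fixed first, then the configuration event \<open>G\<close>, whose
  probability may be tiny, and only then \<epsilon>' and the cells, with errors small relative to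
  \<open>prob G\<close>. On the analytic side the closed span is detected by \<open>infdist\<close>,
  whose sublinearity is compatible with integration.\<close>

lemma borel_measurable_norm_diff_simple:
  fixes f s :: "'a \<Rightarrow> 'b::real_normed_vector"
  assumes "f \<in> borel_measurable M" "simple_function M s"
  shows "(\<lambda>x. norm (f x - s x)) \<in> borel_measurable M"
\<comment> \<open>Without a countable base, subtraction need not be measurable for the product of
  two Borel algebras. As \<open>s\<close> has finitely many values, \<open>f - s\<close> is treated
  one value at a time, where only a continuous function of \<open>f\<close> occurs.\<close>
proof (rule measurable_compose_countable'[where I="s ` space M" and g=s and f="\<lambda>y x. norm (f x - y)"])
  show "(\<lambda>x. norm (f x - y)) \<in> borel_measurable M" for y
    by (rule measurable_compose[OF assms(1)]) (intro borel_measurable_continuous_onI continuous_intros)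
  have "finite (s ` space M)"
    using assms(2) by (auto simp: simple_function_def)
  then show "countable (s ` space M)" by (rule countable_finite)
  then show "s \<in> measurable M (count_space (s ` space M))"
    using assms(2) by (auto simp: measurable_count_space_eq_countable simple_function_def)
qed

text \<open>\<open>bochner\<close> provides one unspecified approximating sequence. Comparing it
  with an arbitrary simple \<open>s\<close> through the triangle inequality gives an estimate for
  any chosen approximant; later one \<open>s\<close> serves the compensator and every path of \<eta>
  at once.\<close>

lemma bochner_simple_diff:
  fixes f :: "'a \<Rightarrow> 'b::real_normed_vector"
  assumes b: "bochner M f y" and s: "Bochner_Integration.simple_bochner_integrable M s"
  shows "ennreal (norm (y - Bochner_Integration.simple_bochner_integral M s))
           \<le> (\<integral>\<^sup>+x. ennreal (norm (f x - s x)) \<partial>M)"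
proof -
  let ?I = "Bochner_Integration.simple_bochner_integral M"
  let ?N = "\<lambda>g h. \<integral>\<^sup>+x. ennreal (norm (g x - h x)) \<partial>M"
  from b obtain t where f: "f \<in> borel_measurable M"
    and t: "\<And>i. Bochner_Integration.simple_bochner_integrable M (t i)"
    and t0: "(\<lambda>i. ?N f (t i)) \<longlonglongrightarrow> 0" and ty: "(\<lambda>i. ?I (t i)) \<longlonglongrightarrow> y"
    unfolding bochner_def by blast
  have meas: "(\<lambda>x. norm (f x - g x)) \<in> borel_measurable M"
    if "Bochner_Integration.simple_bochner_integrable M g" for g
    using borel_measurable_norm_diff_simple[OF f, of g] that
    by (auto elim: Bochner_Integration.simple_bochner_integrable.cases)
  have "ennreal (norm (y - ?I s)) \<le> (ennreal (norm (y - ?I (t i))) + ?N f (t i)) + ?N f s" for i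
  proof -
    have dsi: "Bochner_Integration.simple_bochner_integrable M (\<lambda>x. norm (t i x - s x))"
      by (rule simple_bochner_integrable_compose2[OF _ t s]) simp
    have "ennreal (norm (?I (t i) - ?I s)) = norm (?I (\<lambda>x. t i x - s x))"
      by (simp add: simple_bochner_integral_diff[OF t s])
    also have "\<dots> \<le> ?I (\<lambda>x. norm (t i x - s x))"
      by (intro ennreal_leI simple_bochner_integral_norm_bound
          simple_bochner_integrable_compose2[where p="(-)", OF _ t s]) simp
    also have "\<dots> = ?N (t i) s"
      by (rule simple_bochner_integral_eq_nn_integral[OF dsi]) simp
    also have "\<dots> \<le> (\<integral>\<^sup>+x. ennreal (norm (f x - t i x)) + ennreal (norm (f x - s x)) \<partial>M)"
    proof (rule nn_integral_mono)
      fix x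
      have "norm (t i x - s x) \<le> norm (f x - t i x) + norm (f x - s x)"
        using norm_triangle_ineq4[of "f x - s x" "f x - t i x"] by simp
      then show "ennreal (norm (t i x - s x)) \<le> ennreal (norm (f x - t i x)) + ennreal (norm (f x - s x))"
        by (simp flip: ennreal_plus)
    qed
    also have "\<dots> = ?N f (t i) + ?N f s"
      by (rule nn_integral_add) (simp_all add: meas t s)
    finally have 1: "ennreal (norm (?I (t i) - ?I s)) \<le> ?N f (t i) + ?N f s" .
    have "norm (y - ?I s) \<le> norm (y - ?I (t i)) + norm (?I (t i) - ?I s)"
      by (rule norm_diff_triangle_le[OF order_refl order_refl])
    then have "ennreal (norm (y - ?I s)) \<le> ennreal (norm (y - ?I (t i))) + ennreal (norm (?I (t i) - ?I s))"
      by (simp flip: ennreal_plus)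
    also have "\<dots> \<le> ennreal (norm (y - ?I (t i))) + (?N f (t i) + ?N f s)"
      by (intro add_left_mono 1)
    finally show ?thesis by (simp add: add.assoc)
  qed
  moreover have "(\<lambda>i. (ennreal (norm (y - ?I (t i))) + ?N f (t i)) + ?N f s) \<longlonglongrightarrow> (ennreal (norm (y - y)) + 0) + ?N f s"
    by (intro tendsto_add tendsto_ennrealI tendsto_norm tendsto_diff tendsto_const t0 ty)
  ultimately show ?thesis
    by (intro LIMSEQ_le_const[where X="\<lambda>i. (ennreal (norm (y - ?I (t i))) + ?N f (t i)) + ?N f s"]) auto
qed

text \<open>Near-optimal points of \<open>V\<close>, combined with the same coefficients, stay in
  \<open>V\<close>; this makes the distance to a subspace sublinear.\<close>

lemma infdist_subspace_sum:
  fixes V :: "'b::real_normed_vector set"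
  assumes V: "subspace V" and "\<And>y. y \<in> Y \<Longrightarrow> 0 \<le> c y"
  shows "infdist (\<Sum>y\<in>Y. c y *\<^sub>R g y) V \<le> (\<Sum>y\<in>Y. c y * infdist (g y) V)"
proof -
  have ne: "V \<noteq> {}" using V subspace_0 by auto
  have near: "\<exists>v\<in>V. norm (x - v) < infdist x V + e" if "0 < e" for x e
  proof (rule ccontr)
    assume "\<not> ?thesis"
    then have "infdist x V + e \<le> (INF a\<in>V. dist x a)"
      by (intro cINF_greatest[OF ne]) (auto simp: dist_norm not_less)
    with that show False using ne by (simp add: infdist_notempty)
  qed
  show ?thesis
  proof (cases "finite Y")
    case fin: True
    define C where "C = (\<Sum>y\<in>Y. c y)"
    have C0: "0 \<le> C" unfolding C_def by (rule sum_nonneg) (rule assms(2))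
    show ?thesis
    proof (rule field_le_epsilon)
      fix e :: real assume e: "0 < e"
      \<comment> \<open>The \<open>+ 1\<close> keeps the divisor positive when all coefficients
        vanish.\<close>
      define d where "d = e / (C + 1)"
      have d: "0 < d" using e C0 by (simp add: d_def)
      have "\<forall>y. \<exists>v. v \<in> V \<and> norm (g y - v) < infdist (g y) V + d"
        using near[OF d] by blast
      then obtain v where v: "\<And>y. v y \<in> V" "\<And>y. norm (g y - v y) < infdist (g y) V + d"
        by metis
      have "infdist (\<Sum>y\<in>Y. c y *\<^sub>R g y) V \<le> norm ((\<Sum>y\<in>Y. c y *\<^sub>R g y) - (\<Sum>y\<in>Y. c y *\<^sub>R v y))"
        unfolding dist_norm[symmetric]
        by (intro infdist_le subspace_sum[OF V] subspace_mul[OF V] v)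
      also have "\<dots> = norm (\<Sum>y\<in>Y. c y *\<^sub>R (g y - v y))"
        by (simp add: sum_subtractf scaleR_diff_right)
      also have "\<dots> \<le> (\<Sum>y\<in>Y. c y * (infdist (g y) V + d))"
      proof (rule sum_norm_le)
        fix y assume "y \<in> Y"
        then show "norm (c y *\<^sub>R (g y - v y)) \<le> c y * (infdist (g y) V + d)"
          using assms(2)[of y] mult_left_mono[OF less_imp_le[OF v(2)[of y]], of "c y"] by simp
      qed
      also have "\<dots> = (\<Sum>y\<in>Y. c y * infdist (g y) V) + C * d"
        by (simp add: C_def distrib_left sum.distrib sum_distrib_right)
      also have "C * d \<le> e"
        using e C0 by (simp add: d_def field_simps)
      finally show "infdist (\<Sum>y\<in>Y. c y *\<^sub>R g y) V \<le> (\<Sum>y\<in>Y. c y * infdist (g y) V) + e"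
        by simp
    qed
  qed (use V in \<open>simp add: subspace_0\<close>)
qed

text \<open>The simple approximants may leave \<open>V\<close>, but almost everywhere their distance
  to \<open>V\<close> is at most \<open>norm (f x - t i x)\<close>. Sublinearity carries this over
  to the integrals; the second copy of the error pays for passing from the integral of
  \<open>t i\<close> to \<open>y\<close>.\<close>

lemma bochner_in_closure:
  fixes f :: "'a \<Rightarrow> 'b::real_normed_vector"
  assumes b: "bochner M f y" and V: "subspace V" and ae: "AE x in M. f x \<in> V"
  shows "y \<in> closure V"
proof -
  let ?I = "Bochner_Integration.simple_bochner_integral M"
  let ?N = "\<lambda>g h. \<integral>\<^sup>+x. ennreal (norm (g x - h x)) \<partial>M"
  from b obtain t where f: "f \<in> borel_measurable M"
    and t: "\<And>i. Bochner_Integration.simple_bochner_integrable M (t i)"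
    and t0: "(\<lambda>i. ?N f (t i)) \<longlonglongrightarrow> 0"
    unfolding bochner_def by blast
  have "ennreal (infdist y V) \<le> ?N f (t i) + ?N f (t i)" for i
  proof -
    have V0: "infdist 0 V = 0" using V by (simp add: subspace_0)
    have di: "Bochner_Integration.simple_bochner_integrable M (\<lambda>x. infdist (t i x) V)"
      by (rule simple_bochner_integrable_compose2[where p="\<lambda>a b. infdist a V", OF V0 t t])
    have "infdist (?I (t i)) V \<le> (\<Sum>y\<in>t i ` space M. measure M {x\<in>space M. t i x = y} * infdist y V)"
      unfolding simple_bochner_integral_def by (rule infdist_subspace_sum[OF V]) simp
    also have "\<dots> = ?I (\<lambda>x. infdist (t i x) V)"
      using t[of i] by (subst simple_bochner_integral_partition[OF di, where g="t i" and v="\<lambda>y. infdist y V"])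
        (auto elim: Bochner_Integration.simple_bochner_integrable.cases)
    finally have "ennreal (infdist (?I (t i)) V) \<le> ennreal (?I (\<lambda>x. infdist (t i x) V))"
      by (rule ennreal_leI)
    also have "\<dots> = (\<integral>\<^sup>+x. ennreal (infdist (t i x) V) \<partial>M)"
      by (rule simple_bochner_integral_eq_nn_integral[OF di]) (rule infdist_nonneg)
    also have "\<dots> \<le> ?N f (t i)"
    proof (rule nn_integral_mono_AE)
      show "AE x in M. ennreal (infdist (t i x) V) \<le> ennreal (norm (f x - t i x))"
        using ae
      proof eventually_elim
        case (elim x)
        have "infdist (t i x) V \<le> dist (t i x) (f x)" by (rule infdist_le[OF elim])
        then show ?case by (auto intro!: ennreal_leI simp: dist_norm norm_minus_commute)
      qed
    qed
    finally have 1: "ennreal (infdist (?I (t i)) V) \<le> ?N f (t i)" .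
    have "infdist y V \<le> infdist (?I (t i)) V + norm (y - ?I (t i))"
      unfolding dist_norm[symmetric] by (rule infdist_triangle)
    then have "ennreal (infdist y V) \<le> ennreal (infdist (?I (t i)) V) + ennreal (norm (y - ?I (t i)))"
      by (simp add: infdist_nonneg flip: ennreal_plus)
    also have "\<dots> \<le> ?N f (t i) + ?N f (t i)"
      by (intro add_mono 1 bochner_simple_diff[OF b t])
    finally show ?thesis .
  qed
  moreover have "(\<lambda>i. ?N f (t i) + ?N f (t i)) \<longlonglongrightarrow> 0 + 0"
    by (intro tendsto_add t0)
  ultimately have "ennreal (infdist y V) \<le> 0"
    by (intro LIMSEQ_le_const[where X="\<lambda>i. ?N f (t i) + ?N f (t i)"]) auto
  then have "infdist y V = 0"
    using infdist_nonneg[of y V] by simp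
  then show ?thesis
    using V subspace_0 by (subst in_closure_iff_infdist_zero) auto
qed

subsection \<open>Counts of a Poisson random measure\<close>

locale poisson_measure = prob_space P for P :: "'w measure" +
  fixes F :: "real \<Rightarrow> 'w measure" and \<nu> :: "real measure"
    and \<eta> :: "'w \<Rightarrow> (real \<times> real) measure"
  assumes prm: "poisson_random_measure P F \<nu> \<eta>"
begin

abbreviation Q :: "(real \<times> real) measure" where
  "Q \<equiv> compensator \<nu>"

lemma sets_eta: "\<omega> \<in> space P \<Longrightarrow> sets (\<eta> \<omega>) = sets Q"
  using prm by (simp add: poisson_random_measure_def)

lemma borel_measurable_count [measurable]:
  "U \<in> sets Q \<Longrightarrow> (\<lambda>\<omega>. emeasure (\<eta> \<omega>) U) \<in> borel_measurable P"
  using prm by (simp add: poisson_random_measure_def)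

lemma prob_count:
  assumes "U \<in> sets Q" "emeasure Q U < \<infinity>"
  shows "prob {\<omega> \<in> space P. emeasure (\<eta> \<omega>) U = of_nat n} =
           exp (- measure Q U) * measure Q U ^ n / fact n"
  using prm assms unfolding poisson_random_measure_def by blast

lemma prob_count_nonzero_le:
  assumes U: "U \<in> sets Q" "emeasure Q U < \<infinity>"
  shows "prob {\<omega> \<in> space P. emeasure (\<eta> \<omega>) U \<noteq> 0} \<le> measure Q U"
proof -
  have "prob {\<omega> \<in> space P. emeasure (\<eta> \<omega>) U \<noteq> 0} = 1 - prob {\<omega> \<in> space P. emeasure (\<eta> \<omega>) U = 0}"
    using U(1) by (subst prob_neg) auto
  also have "\<dots> = 1 - exp (- measure Q U)"
    using prob_count[OF U, of 0] by simp
  also have "\<dots> \<le> measure Q U"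
    using exp_ge_add_one_self[of "- measure Q U"] by simp
  finally show ?thesis .
qed

text \<open>Poisson probabilities sum to one, so no mass sits at infinity. The bound
  \<open>K\<close> later limits how many jumps can contribute an approximation error.\<close>

lemma count_tight:
  assumes U: "U \<in> sets Q" "emeasure Q U < \<infinity>" and "0 < \<theta>"
  shows "\<exists>K. prob {\<omega> \<in> space P. \<not> emeasure (\<eta> \<omega>) U \<le> of_nat K} < \<theta>"
proof -
  let ?m = "measure Q U"
  let ?E = "\<lambda>n. {\<omega> \<in> space P. emeasure (\<eta> \<omega>) U = of_nat n}"
  have "(\<lambda>n. exp (- ?m) * (?m ^ n /\<^sub>R fact n)) sums (exp (- ?m) * exp ?m)"
    by (rule sums_mult[OF exp_converges])
  then have "(\<lambda>n. prob (?E n)) sums 1"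
    by (simp add: prob_count[OF U] exp_minus_inverse divide_inverse ac_simps exp_minus)
  then have "(\<lambda>K. \<Sum>n<K. prob (?E n)) \<longlonglongrightarrow> 1"
    by (simp add: sums_def)
  then have "eventually (\<lambda>K. 1 - \<theta> < (\<Sum>n<K. prob (?E n))) sequentially"
    by (rule order_tendstoD) (use \<open>0 < \<theta>\<close> in simp)
  then obtain K where K: "1 - \<theta> < (\<Sum>n<K. prob (?E n))"
    by (auto simp: eventually_sequentially)
  have "(\<Sum>n<K. prob (?E n)) = prob (\<Union>n<K. ?E n)"
    by (rule finite_measure_finite_Union[symmetric])
      (use U in \<open>auto simp: disjoint_family_on_def\<close>)
  also have "\<dots> \<le> prob {\<omega> \<in> space P. emeasure (\<eta> \<omega>) U \<le> of_nat K}"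
    using U by (intro finite_measure_mono) auto
  finally have "1 - \<theta> < prob {\<omega> \<in> space P. emeasure (\<eta> \<omega>) U \<le> of_nat K}"
    using K by simp
  moreover have "prob {\<omega> \<in> space P. \<not> emeasure (\<eta> \<omega>) U \<le> of_nat K} =
      1 - prob {\<omega> \<in> space P. emeasure (\<eta> \<omega>) U \<le> of_nat K}"
    using U(1) by (subst prob_neg) auto
  ultimately show ?thesis by (intro exI[of _ K]) simp
qed

lemma indep_vars_counts:
  assumes I: "finite I" and U: "\<And>i. i \<in> I \<Longrightarrow> U i \<in> sets Q" and dis: "disjoint_family_on U I"
  shows "indep_vars (\<lambda>_. borel) (\<lambda>i \<omega>. emeasure (\<eta> \<omega>) (U i)) I"
proof -
  from prm have indep: "\<forall>(n::nat) U. (\<forall>i<n. U i \<in> sets Q) \<longrightarrow> disjoint_family_on U {..<n} \<longrightarrow>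
      indep_vars (\<lambda>_. borel) (\<lambda>i \<omega>. emeasure (\<eta> \<omega>) (U i)) {..<n}"
    unfolding poisson_random_measure_def by (elim conjE) assumption
  obtain g where g: "bij_betw g I {..<card I}"
    using ex_bij_betw_finite_nat[OF I] by (auto simp: atLeast0LessThan)
  define f where "f = the_inv_into I g"
  have fg: "f (g i) = i" if "i \<in> I" for i
    using g that by (simp add: f_def the_inv_into_f_f bij_betw_def)
  have f: "bij_betw f {..<card I} I"
    unfolding f_def by (rule bij_betw_the_inv_into[OF g])
  have fI: "f j \<in> I" if "j < card I" for j
    using bij_betwE[OF f] that by auto
  have "disjoint_family_on (\<lambda>j. U (f j)) {..<card I}"
    using dis f fI unfolding disjoint_family_on_def bij_betw_def inj_on_def by (metis lessThan_iff)
  then have ind: "indep_vars (\<lambda>_. borel) (\<lambda>j \<omega>. emeasure (\<eta> \<omega>) (U (f j))) {..<card I}"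
    using indep U fI by simp
  \<comment> \<open>Reindexing along \<open>g\<close> is obtained by grouping the variables into
    singleton blocks \<open>{g i}\<close> and then evaluating each block at its only
    coordinate.\<close>
  have "indep_vars (\<lambda>i. PiM {g i} (\<lambda>_. borel))
      (\<lambda>i \<omega>. restrict (\<lambda>j. emeasure (\<eta> \<omega>) (U (f j))) {g i}) I"
  proof (rule indep_vars_restrict[OF ind])
    show "{g i} \<subseteq> {..<card I}" if "i \<in> I" for i
      using bij_betwE[OF g] that by auto
    show "disjoint_family_on (\<lambda>i. {g i}) I"
      using g by (auto simp: disjoint_family_on_def bij_betw_def inj_on_def)
  qed
  then have "indep_vars (\<lambda>_. borel)
      (\<lambda>i \<omega>. (restrict (\<lambda>j. emeasure (\<eta> \<omega>) (U (f j))) {g i}) (g i)) I"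
    by (rule indep_vars_compose2) (rule measurable_component_singleton, simp)
  then show ?thesis
    by (rule indep_vars_cong[THEN iffD1, rotated -1]) (auto simp: fg)
qed

text \<open>\<open>A\<close> indexes the cells with prescribed counts, \<open>B\<close> the cells
  from which the real variable \<open>X\<close> is computed. Both are read off disjoint groups of
  independent counts.\<close>

lemma prob_counts_indep:
  fixes n :: "'i \<Rightarrow> nat" and h :: "('i \<Rightarrow> ennreal) \<Rightarrow> real"
  assumes fin: "finite A" "finite B" and A: "A \<noteq> {}" and AB: "A \<inter> B = {}"
    and U: "\<And>i. i \<in> A \<union> B \<Longrightarrow> U i \<in> sets Q" and dis: "disjoint_family_on U (A \<union> B)"
    and h: "h \<in> borel_measurable (PiM B (\<lambda>_. borel))"
  defines "G \<equiv> {\<omega> \<in> space P. \<forall>i\<in>A. emeasure (\<eta> \<omega>) (U i) = of_nat (n i)}"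
    and "X \<equiv> \<lambda>\<omega>. h (\<lambda>i\<in>B. emeasure (\<eta> \<omega>) (U i))"
  shows "X \<in> borel_measurable P"
    and "prob (G \<inter> {\<omega> \<in> space P. a < X \<omega>}) = prob G * prob {\<omega> \<in> space P. a < X \<omega>}"
proof -
  have ind: "indep_vars (\<lambda>_. borel) (\<lambda>i \<omega>. emeasure (\<eta> \<omega>) (U i)) (A \<union> B)"
    by (rule indep_vars_counts) (use fin U dis in auto)
  have "(\<lambda>\<omega>. \<lambda>i\<in>B. emeasure (\<eta> \<omega>) (U i)) \<in> measurable P (PiM B (\<lambda>_. borel))"
    by (rule measurable_restrict) (use U in auto)
  then show "X \<in> borel_measurable P"
    unfolding X_def using h by (rule measurable_compose)
  have iv: "indep_var (PiM A (\<lambda>_. borel)) (\<lambda>\<omega>. \<lambda>i\<in>A. emeasure (\<eta> \<omega>) (U i))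
      (PiM B (\<lambda>_. borel)) (\<lambda>\<omega>. \<lambda>i\<in>B. emeasure (\<eta> \<omega>) (U i))"
    by (rule indep_var_restrict[OF ind AB]) auto
  define GA where "GA = (PiE A (\<lambda>i. {of_nat (n i) :: ennreal}))"
  define XB where "XB = {x \<in> space (PiM B (\<lambda>_. borel :: ennreal measure)). a < h x}"
  have GA: "GA \<in> sets (PiM A (\<lambda>_. borel))"
    unfolding GA_def by (rule sets_PiM_I_finite) (use fin in auto)
  have XB: "XB \<in> sets (PiM B (\<lambda>_. borel))"
    unfolding XB_def using h by measurable
  have 1: "(\<lambda>\<omega>. \<lambda>i\<in>A. emeasure (\<eta> \<omega>) (U i)) -` GA \<inter> space P = G"
    by (auto simp: GA_def G_def PiE_def Pi_def)
  have 2: "(\<lambda>\<omega>. \<lambda>i\<in>B. emeasure (\<eta> \<omega>) (U i)) -` XB \<inter> space P = {\<omega> \<in> space P. a < X \<omega>}"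
    by (auto simp: XB_def X_def space_PiM)
  have 3: "(\<lambda>x. (\<lambda>i\<in>A. emeasure (\<eta> x) (U i), \<lambda>i\<in>B. emeasure (\<eta> x) (U i))) -` (GA \<times> XB) \<inter> space P
     = G \<inter> {\<omega> \<in> space P. a < X \<omega>}"
    using 1 2 by blast
  show "prob (G \<inter> {\<omega> \<in> space P. a < X \<omega>}) = prob G * prob {\<omega> \<in> space P. a < X \<omega>}"
    using indep_varD[OF iv GA XB] unfolding 1 2 3 .
qed

lemma prob_counts_pos:
  fixes n :: "'i \<Rightarrow> nat"
  assumes fin: "finite A" and A: "A \<noteq> {}"
    and U: "\<And>i. i \<in> A \<Longrightarrow> U i \<in> sets Q" and dis: "disjoint_family_on U A"
    and finQ: "\<And>i. i \<in> A \<Longrightarrow> emeasure Q (U i) < \<infinity>"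
    and pos: "\<And>i. i \<in> A \<Longrightarrow> n i = 0 \<or> 0 < emeasure Q (U i)"
  defines "G \<equiv> {\<omega> \<in> space P. \<forall>i\<in>A. emeasure (\<eta> \<omega>) (U i) = of_nat (n i)}"
  shows "G \<in> events" and "0 < prob G"
proof -
  show "G \<in> events"
    unfolding G_def using fin U by (intro sets.sets_Collect_finite_All) auto
  have ind: "indep_vars (\<lambda>_. borel) (\<lambda>i \<omega>. emeasure (\<eta> \<omega>) (U i)) A"
    by (rule indep_vars_counts) (use fin U dis in auto)
  have "G = (\<Inter>i\<in>A. (\<lambda>\<omega>. emeasure (\<eta> \<omega>) (U i)) -` {of_nat (n i)} \<inter> space P)"
    using A by (auto simp: G_def)
  then have "prob G = (\<Prod>i\<in>A. prob ((\<lambda>\<omega>. emeasure (\<eta> \<omega>) (U i)) -` {of_nat (n i)} \<inter> space P))"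
    using indep_varsD_finite[OF ind A fin, of "\<lambda>i. {of_nat (n i)}"] by simp
  also have "\<dots> > 0"
  proof (rule prod_pos)
    fix i assume i: "i \<in> A"
    have "(\<lambda>\<omega>. emeasure (\<eta> \<omega>) (U i)) -` {of_nat (n i)} \<inter> space P
        = {\<omega> \<in> space P. emeasure (\<eta> \<omega>) (U i) = of_nat (n i)}" by auto
    moreover have "0 < exp (- measure Q (U i)) * measure Q (U i) ^ n i / fact (n i)"
      using pos[OF i] finQ[OF i]
      by (cases "n i = 0") (auto simp: measure_def enn2real_positive_iff)
    ultimately show "0 < prob ((\<lambda>\<omega>. emeasure (\<eta> \<omega>) (U i)) -` {of_nat (n i)} \<inter> space P)"
      using prob_count[OF U[OF i] finQ[OF i]] by simp
  qed
  finally show "0 < prob G" .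
qed

end

subsection \<open>Sums over finitely many jumps\<close>

text \<open>The sum runs over a fixed finite set \<open>Y\<close> instead of the image of
  \<open>s\<close>, so that the same expression can be formed for different measures and different
  sets \<open>A\<close>; values not attained contribute zero.\<close>

lemma bochner_restrict_sum_diff:
  fixes f s :: "'a \<Rightarrow> 'b::real_normed_vector"
  assumes A: "A \<in> sets \<mu>" "emeasure \<mu> A < \<infinity>" and b: "bochner (restrict_space \<mu> A) f y"
    and Y: "finite Y" "\<And>p. p \<in> A \<Longrightarrow> s p \<in> Y"
    and lev: "\<And>v. v \<in> Y \<Longrightarrow> {p \<in> A. s p = v} \<in> sets \<mu>"
  shows "ennreal (norm (y - (\<Sum>v\<in>Y. measure \<mu> {p \<in> A. s p = v} *\<^sub>R v)))
           \<le> (\<integral>\<^sup>+p. ennreal (norm (f p - s p)) \<partial>restrict_space \<mu> A)"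
proof -
  let ?R = "restrict_space \<mu> A"
  have sp: "space ?R = A"
    using sets.sets_into_space[OF A(1)] by (auto simp: space_restrict_space)
  have setsR: "C \<in> sets ?R \<longleftrightarrow> C \<subseteq> A \<and> C \<in> sets \<mu>" for C
    using A(1) sets.sets_into_space[OF A(1)] by (intro sets_restrict_space_iff) (simp add: Int_absorb2)
  have eR: "emeasure ?R C = emeasure \<mu> C" if "C \<subseteq> A" for C
    using A(1) that by (intro emeasure_restrict_space) (auto intro: sets.Int)
  have sf: "simple_function ?R s"
    unfolding simple_function_def sp
  proof (intro conjI ballI)
    show "finite (s ` A)" using Y by (auto intro: finite_subset)
    fix v assume "v \<in> s ` A"
    then have "{p \<in> A. s p = v} \<in> sets \<mu>" using Y lev by auto
    moreover have "s -` {v} \<inter> A = {p \<in> A. s p = v}" by auto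
    ultimately show "s -` {v} \<inter> A \<in> sets ?R" by (simp add: setsR)
  qed
  have si: "Bochner_Integration.simple_bochner_integrable ?R s"
  proof
    have "emeasure ?R {x \<in> space ?R. s x \<noteq> 0} \<le> emeasure ?R A"
      by (rule emeasure_mono) (auto simp: sp setsR A)
    also have "\<dots> < \<infinity>" using A by (simp add: eR)
    finally show "emeasure ?R {x \<in> space ?R. s x \<noteq> 0} \<noteq> \<infinity>" by simp
  qed (rule sf)
  have "Bochner_Integration.simple_bochner_integral ?R s
      = (\<Sum>v\<in>s ` A. measure \<mu> {p \<in> A. s p = v} *\<^sub>R v)"
    unfolding simple_bochner_integral_def sp
    by (intro sum.cong refl arg_cong2[where f=scaleR]) (simp add: measure_def eR)
  also have "\<dots> = (\<Sum>v\<in>Y. measure \<mu> {p \<in> A. s p = v} *\<^sub>R v)"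
  proof (rule sum.mono_neutral_left[OF Y(1)])
    show "s ` A \<subseteq> Y" using Y by auto
    show "\<forall>v\<in>Y - s ` A. measure \<mu> {p \<in> A. s p = v} *\<^sub>R v = 0"
    proof
      fix v assume "v \<in> Y - s ` A"
      then have "{p \<in> A. s p = v} = {}" by auto
      then show "measure \<mu> {p \<in> A. s p = v} *\<^sub>R v = 0" by (metis measure_empty scaleR_zero_left)
    qed
  qed
  finally show ?thesis
    using bochner_simple_diff[OF b si] by simp
qed

text \<open>For a path measure, \<open>N\<close> being null means that no jump falls into
  \<open>N\<close>. Thus \<open>s\<close> has to be close to \<open>f\<close> only at jumps that
  occur, and the error is at most \<rho> per jump.\<close>

lemma bochner_restrict_sum_diff_bounded:
  fixes f s :: "'a \<Rightarrow> 'b::real_normed_vector"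
  assumes A: "A \<in> sets \<mu>" "emeasure \<mu> A < \<infinity>" and b: "bochner (restrict_space \<mu> A) f y"
    and Y: "finite Y" "\<And>p. p \<in> A \<Longrightarrow> s p \<in> Y"
    and lev: "\<And>v. v \<in> Y \<Longrightarrow> {p \<in> A. s p = v} \<in> sets \<mu>"
    and N: "N \<in> sets \<mu>" "emeasure \<mu> N = 0"
    and \<rho>: "0 \<le> \<rho>" "\<And>p. p \<in> A - N \<Longrightarrow> norm (f p - s p) \<le> \<rho>"
  shows "norm (y - (\<Sum>v\<in>Y. measure \<mu> {p \<in> A. s p = v} *\<^sub>R v)) \<le> \<rho> * measure \<mu> A"
proof -
  have As: "A \<inter> space \<mu> \<in> sets \<mu>" using A by auto
  have "ennreal (norm (y - (\<Sum>v\<in>Y. measure \<mu> {p \<in> A. s p = v} *\<^sub>R v)))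
      \<le> (\<integral>\<^sup>+p. ennreal (norm (f p - s p)) \<partial>restrict_space \<mu> A)"
    by (rule bochner_restrict_sum_diff[OF A b Y lev])
  also have "\<dots> \<le> (\<integral>\<^sup>+p. ennreal \<rho> \<partial>restrict_space \<mu> A)"
  proof (rule nn_integral_mono_AE)
    have "AE p in \<mu>. p \<notin> N"
      using N by (intro AE_not_in) (simp add: null_sets_def)
    then show "AE p in restrict_space \<mu> A. ennreal (norm (f p - s p)) \<le> ennreal \<rho>"
      unfolding AE_restrict_space_iff[OF As]
      by eventually_elim (use \<rho> in \<open>auto intro!: ennreal_leI\<close>)
  qed
  also have "\<dots> = ennreal \<rho> * emeasure \<mu> A"
    using A(1) sets.sets_into_space[OF A(1)]
    by (simp add: emeasure_restrict_space As space_restrict_space Int_absorb2)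
  also have "\<dots> = ennreal (\<rho> * measure \<mu> A)"
    using A(2) \<rho>(1) by (simp add: emeasure_eq_ennreal_measure ennreal_mult)
  finally show ?thesis
    using \<rho>(1) by (simp add: ennreal_le_iff)
qed

lemma sum_list_eq_sum_count_scaleR:
  fixes l :: "'b::real_vector list"
  assumes "finite Y" "set l \<subseteq> Y"
  shows "sum_list l = (\<Sum>v\<in>Y. real (count_list l v) *\<^sub>R v)"
  using assms(2)
proof (induction l)
  case (Cons a l)
  have "(\<Sum>v\<in>Y. real (count_list (a # l) v) *\<^sub>R v)
      = (\<Sum>v\<in>Y. (if a = v then v else 0) + real (count_list l v) *\<^sub>R v)"
    by (intro sum.cong) (auto simp: algebra_simps)
  then show ?case
    using Cons assms(1) by (simp add: sum.distrib)
qed simp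

text \<open>The list \<open>l\<close> holds the desired contributions of single jumps, with
  multiplicity. Exactly \<open>count_list l v\<close> jumps are prescribed in the region where
  \<open>f\<close> is near \<open>v\<close>, and none in the rest of \<open>A\<close>. The index
  \<open>Some v\<close> stands for the region around \<open>v\<close> and \<open>None\<close> for
  the rest; \<mu> is arbitrary because the path measure varies with \<omega>.\<close>

lemma jump_configuration:
  fixes f :: "'p \<Rightarrow> 'h::real_normed_vector"
  assumes A: "A \<in> sets M" and f: "f \<in> borel_measurable (restrict_space M A)"
    and l: "\<And>v \<rho>. v \<in> set l \<Longrightarrow> 0 < \<rho> \<Longrightarrow> 0 < emeasure M {p \<in> A. norm (f p - v) < \<rho>}"
    and e: "0 < e"
  obtains U :: "'h option \<Rightarrow> 'p set" and n I where
    "finite I" "I \<noteq> {}" "\<And>i. i \<in> I \<Longrightarrow> U i \<in> sets M" "\<And>i. i \<in> I \<Longrightarrow> U i \<subseteq> A"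
    "disjoint_family_on U I" "\<And>i. i \<in> I \<Longrightarrow> n i = 0 \<or> 0 < emeasure M (U i)"
    "\<And>\<mu> y. sets \<mu> = sets M \<Longrightarrow> (\<And>i. i \<in> I \<Longrightarrow> emeasure \<mu> (U i) = of_nat (n i)) \<Longrightarrow>
       bochner (restrict_space \<mu> A) f y \<Longrightarrow> norm (y - sum_list l) \<le> e"
proof -
  have setsR: "C \<in> sets (restrict_space M A) \<longleftrightarrow> C \<subseteq> A \<and> C \<in> sets M" for C
    using A(1) sets.sets_into_space[OF A(1)] by (intro sets_restrict_space_iff) (simp add: Int_absorb2)
  have sp: "space (restrict_space M A) = A"
    using sets.sets_into_space[OF A(1)] by (auto simp: space_restrict_space)
  \<comment> \<open>The element \<open>1\<close> makes the minimum meaningful when \<open>l\<close>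
    has fewer than two distinct entries.\<close>
  define d where "d = Min (insert 1 ((\<lambda>(u, v). dist u v) ` {(u, v) \<in> set l \<times> set l. u \<noteq> v}))"
  have finD: "finite (insert 1 ((\<lambda>(u, v). dist u v) ` {(u, v) \<in> set l \<times> set l. u \<noteq> v}))"
    by (intro finite.insertI finite_imageI) (rule finite_subset[of _ "set l \<times> set l"], auto)
  have d: "0 < d"
    unfolding d_def using finD by (subst Min_gr_iff) auto
  have dd: "d \<le> dist u v" if "u \<in> set l" "v \<in> set l" "u \<noteq> v" for u v
    unfolding d_def using that by (intro Min_le[OF finD]) force
  \<comment> \<open>The first bound makes the regions around distinct entries disjoint, the second
    keeps \<open>length l\<close> errors of size \<rho> below \<open>e\<close>.\<close>
  define \<rho> where "\<rho> = min (d / 2) (e / (length l + 1))"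
  have \<rho>: "0 < \<rho>" using d e by (simp add: \<rho>_def)
  define V where "V v = {p \<in> A. norm (f p - v) < \<rho>}" for v
  have VA: "V v \<subseteq> A" for v by (auto simp: V_def)
  have Vm: "V v \<in> sets M" for v
  proof -
    have "(\<lambda>p. norm (f p - v)) \<in> borel_measurable (restrict_space M A)"
      by (rule measurable_compose[OF f]) (intro borel_measurable_continuous_onI continuous_intros)
    then have "{p \<in> space (restrict_space M A). norm (f p - v) < \<rho>} \<in> sets (restrict_space M A)"
      by measurable
    then show ?thesis by (simp add: sp setsR V_def)
  qed
  have Vdis: "V u \<inter> V v = {}" if "u \<in> set l" "v \<in> set l" "u \<noteq> v" for u v
  proof (rule ccontr)
    assume "V u \<inter> V v \<noteq> {}"
    then obtain p where "norm (f p - u) < \<rho>" "norm (f p - v) < \<rho>" by (auto simp: V_def)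
    then have "dist u v < \<rho> + \<rho>"
      by (intro dist_triangle_less_add[of u "f p" \<rho> v \<rho>]) (simp_all add: dist_norm norm_minus_commute)
    also have "\<dots> \<le> d" unfolding \<rho>_def by simp
    finally show False using dd[OF that] by simp
  qed
  define N where "N = A - (\<Union>v\<in>set l. V v)"
  have Nm: "N \<in> sets M" unfolding N_def using A Vm by (intro sets.Diff sets.finite_UN) auto
  define s where "s p = (if p \<in> N then 0 else (THE v. v \<in> set l \<and> p \<in> V v))" for p
  have sV: "s p = v" if "v \<in> set l" "p \<in> V v" for p v
    using that Vdis VA by (auto simp: s_def N_def intro!: the_equality)
  have sN: "s p = 0" if "p \<in> N" for p using that by (simp add: s_def)
  define Y where "Y = insert 0 (set l)"
  have sY: "s p \<in> Y" if "p \<in> A" for p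
    using that sV sN by (cases "p \<in> N") (auto simp: Y_def N_def)
  have mem: "s p = v \<longleftrightarrow> v \<in> set l \<and> p \<in> V v \<or> v = 0 \<and> p \<in> N" if p: "p \<in> A" for p v
  proof (cases "p \<in> N")
    case True
    then have "p \<notin> V v" if "v \<in> set l" using that by (auto simp: N_def)
    then show ?thesis using True sN by auto
  next
    case False
    then obtain u where u: "u \<in> set l" "p \<in> V u" using p by (auto simp: N_def)
    then have "p \<notin> V v" if "v \<in> set l" "v \<noteq> u" using that Vdis[of u v] by auto
    then show ?thesis using False u sV[OF u] by metis
  qed
  have lev: "{p \<in> A. s p = v} = (if v \<in> set l then V v else {}) \<union> (if v = 0 then N else {})" for v
    unfolding set_eq_iff
  proof
    fix p
    show "p \<in> {p \<in> A. s p = v} \<longleftrightarrow> p \<in> (if v \<in> set l then V v else {}) \<union> (if v = 0 then N else {})"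
      using mem[of p v] VA[of v] by (cases "p \<in> A") (auto simp: N_def)
  qed
  define I where "I = insert None (Some ` set l)"
  define U where "U i = (case i of None \<Rightarrow> N | Some v \<Rightarrow> V v)" for i
  define n where "n i = (case i of None \<Rightarrow> 0 | Some v \<Rightarrow> count_list l v)" for i
  show ?thesis
  proof (rule that[of I U n])
    show "finite I" "I \<noteq> {}" by (auto simp: I_def)
    show "U i \<in> sets M" "U i \<subseteq> A" if "i \<in> I" for i
      using Nm Vm VA by (auto simp: U_def N_def split: option.split)
    show "disjoint_family_on U I"
      using Vdis by (fastforce simp: disjoint_family_on_def I_def U_def N_def)
    show "n i = 0 \<or> 0 < emeasure M (U i)" if "i \<in> I" for i
      using l[OF _ \<rho>] that by (auto simp: n_def U_def V_def I_def split: option.split)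
    fix \<mu> y assume \<mu>: "sets \<mu> = sets M" and cnt: "\<And>i. i \<in> I \<Longrightarrow> emeasure \<mu> (U i) = of_nat (n i)"
      and b: "bochner (restrict_space \<mu> A) f y"
    have N0: "emeasure \<mu> N = 0" using cnt[of None] by (simp add: I_def U_def n_def)
    have Vn: "emeasure \<mu> (V v) = of_nat (count_list l v)" if "v \<in> set l" for v
      using cnt[of "Some v"] that by (simp add: I_def U_def n_def)
    have "A = N \<union> (\<Union>v\<in>set l. V v)" using VA by (auto simp: N_def)
    then have "emeasure \<mu> A = emeasure \<mu> N + emeasure \<mu> (\<Union>v\<in>set l. V v)"
      using Nm Vm \<mu> by (metis N_def Diff_disjoint inf_commute plus_emeasure sets.finite_UN finite_set)
    also have "emeasure \<mu> (\<Union>v\<in>set l. V v) = (\<Sum>v\<in>set l. emeasure \<mu> (V v))"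
      by (rule sum_emeasure[symmetric])
        (use Vm \<mu> Vdis in \<open>auto simp: disjoint_family_on_def\<close>)
    also have "\<dots> = of_nat (length l)"
      by (simp add: Vn sum_count_set flip: of_nat_sum)
    finally have A\<mu>: "emeasure \<mu> A = of_nat (length l)" by (simp add: N0)
    have "norm (y - (\<Sum>v\<in>Y. measure \<mu> {p \<in> A. s p = v} *\<^sub>R v)) \<le> \<rho> * measure \<mu> A"
    proof (rule bochner_restrict_sum_diff_bounded[OF _ _ b _ sY, where N=N])
      show "A \<in> sets \<mu>" using A \<mu> by simp
      show "emeasure \<mu> A < \<infinity>" by (simp add: A\<mu> of_nat_less_top)
      show "finite Y" by (simp add: Y_def)
      show "{p \<in> A. s p = v} \<in> sets \<mu>" if "v \<in> Y" for v
        using Vm Nm by (simp add: lev \<mu>)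
      show "N \<in> sets \<mu>" "emeasure \<mu> N = 0" using Nm N0 \<mu> by auto
      show "0 \<le> \<rho>" using \<rho> by simp
      show "norm (f p - s p) \<le> \<rho>" if p: "p \<in> A - N" for p
      proof -
        obtain v where v: "v \<in> set l" "p \<in> V v" using p by (auto simp: N_def)
        then show ?thesis using sV[OF v] by (auto simp: V_def)
      qed
    qed
    also have "(\<Sum>v\<in>Y. measure \<mu> {p \<in> A. s p = v} *\<^sub>R v) = (\<Sum>v\<in>Y. real (count_list l v) *\<^sub>R v)"
    proof (rule sum.cong[OF refl])
      fix v assume v: "v \<in> Y"
      show "measure \<mu> {p \<in> A. s p = v} *\<^sub>R v = real (count_list l v) *\<^sub>R v"
      \<comment> \<open>For \<open>v = 0\<close> the level set also includes \<open>N\<close>, but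
        the coefficients need not be compared there: they multiply the zero vector.\<close>
      proof (cases "v = 0")
        case False
        then show ?thesis using v by (simp add: lev Y_def measure_def Vn)
      qed simp
    qed
    also have "\<dots> = sum_list l"
      by (rule sum_list_eq_sum_count_scaleR[symmetric]) (auto simp: Y_def)
    also have "\<rho> * measure \<mu> A \<le> e / (length l + 1) * length l"
    proof -
      have "measure \<mu> A = length l" by (simp add: measure_def A\<mu>)
      then show ?thesis by (auto simp: \<rho>_def intro!: mult_right_mono simp del: times_divide_eq_left)
    qed
    also have "\<dots> \<le> e" using e by (simp add: field_simps)
    finally show "norm (y - sum_list l) \<le> e" .
  qed
qed

context poisson_measure
begin

text \<open>The counts of the sets \<open>U v\<close> are independent of those of any sets inside \<open>A\<close>.\<close>

lemma compensated_difference_approx: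
  fixes f :: "real \<times> real \<Rightarrow> 'h::real_inner"
  assumes A: "A \<in> sets Q" "A' \<in> sets Q" "A \<subseteq> A'" "emeasure Q A' < \<infinity>"
    and c': "bochner (restrict_space Q A') f c'" and c: "bochner (restrict_space Q A) f c"
    and J': "AE \<omega> in P. bochner (restrict_space (\<eta> \<omega>) A') f (J' \<omega> + c')"
    and J: "AE \<omega> in P. bochner (restrict_space (\<eta> \<omega>) A) f (J \<omega> + c)"
    and e: "0 < e" and \<theta>: "0 < \<theta>"
  obtains Y :: "'h set" and U h Bad where
    "finite Y" "\<And>v. v \<in> Y \<Longrightarrow> U v \<in> sets Q" "\<And>v. v \<in> Y \<Longrightarrow> U v \<subseteq> A' - A" "disjoint_family_on U Y"
    "h \<in> borel_measurable (PiM Y (\<lambda>_. borel))" "Bad \<in> events" "prob Bad < \<theta>"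
    "AE \<omega> in P. \<omega> \<notin> Bad \<longrightarrow>
       \<bar>norm (J' \<omega> - J \<omega>) - h (\<lambda>v\<in>Y. emeasure (\<eta> \<omega>) (U v))\<bar> \<le> e"
proof -
  let ?R = "restrict_space Q A'"
  have spR: "space ?R = A'"
    using sets.sets_into_space[OF A(2)] by (auto simp: space_restrict_space)
  have setsR: "C \<in> sets ?R \<longleftrightarrow> C \<subseteq> A' \<and> C \<in> sets Q" for C
    using A(2) sets.sets_into_space[OF A(2)] by (intro sets_restrict_space_iff) (simp add: Int_absorb2)
  have eR: "emeasure ?R C = emeasure Q C" if "C \<subseteq> A'" for C
    using A(2) that by (intro emeasure_restrict_space) (auto intro: sets.Int)
  have finA: "emeasure Q A < \<infinity>"
    using emeasure_mono[OF A(3,2)] A(4) by (auto intro: le_less_trans)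
  obtain K where K: "prob {\<omega> \<in> space P. \<not> emeasure (\<eta> \<omega>) A' \<le> of_nat K} < \<theta> / 2"
    using count_tight[OF A(2,4), of "\<theta> / 2"] \<theta> by auto
  \<comment> \<open>At most \<open>K\<close> jumps, each with error at most \<rho>, keep either
    pathwise error below \<open>e / 4\<close>.\<close>
  define \<rho> where "\<rho> = e / (4 * (real K + 1))"
  have \<rho>: "0 < \<rho>" using e by (simp add: \<rho>_def add_pos_nonneg)
  have \<rho>K: "\<rho> * K \<le> e / 4" using e by (simp add: \<rho>_def field_simps)
  \<comment> \<open>The bound \<open>e / 4\<close> serves the two compensators; the bound
    \<open>\<rho> * (\<theta> / 4)\<close> lets Markov's inequality give
    \<open>measure Q N \<le> \<theta> / 4\<close> for the set \<open>N\<close> below.\<close>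
  define \<beta> where "\<beta> = min (e / 4) (\<rho> * (\<theta> / 4))"
  have \<beta>: "0 < \<beta>" using e \<rho> \<theta> by (simp add: \<beta>_def)
  from c' obtain t where f: "f \<in> borel_measurable ?R"
    and t: "\<And>i. Bochner_Integration.simple_bochner_integrable ?R (t i)"
    and t0: "(\<lambda>i. \<integral>\<^sup>+p. ennreal (norm (f p - t i p)) \<partial>?R) \<longlonglongrightarrow> 0"
    unfolding bochner_def by blast
  have "eventually (\<lambda>i. (\<integral>\<^sup>+p. ennreal (norm (f p - t i p)) \<partial>?R) < ennreal \<beta>) sequentially"
    by (rule order_tendstoD[OF t0]) (use \<beta> in simp)
  then obtain i where i: "(\<integral>\<^sup>+p. ennreal (norm (f p - t i p)) \<partial>?R) < ennreal \<beta>"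
    by (auto simp: eventually_sequentially)
  define s where "s = t i"
  have s\<beta>: "(\<integral>\<^sup>+p. ennreal (norm (f p - s p)) \<partial>?R) \<le> ennreal \<beta>"
    using i by (simp add: s_def less_imp_le)
  have sf: "simple_function ?R s"
    using t[of i] by (auto simp: s_def elim: Bochner_Integration.simple_bochner_integrable.cases)
  have nm: "(\<lambda>p. norm (f p - s p)) \<in> borel_measurable ?R"
    by (rule borel_measurable_norm_diff_simple[OF f sf])
  define Y where "Y = s ` A'"
  have Y: "finite Y" using sf by (simp add: simple_function_def spR Y_def)
  have lev': "{p \<in> A'. s p = v} \<in> sets Q" for v
  proof -
    have "s -` {v} \<inter> space ?R \<in> sets ?R"
      by (rule simple_functionD(2)[OF sf])
    moreover have "s -` {v} \<inter> space ?R = {p \<in> A'. s p = v}" by (auto simp: spR)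
    ultimately show ?thesis by (simp add: setsR)
  qed
  have "{p \<in> A. s p = v} = {p \<in> A'. s p = v} \<inter> A" for v using A by auto
  then have lev: "{p \<in> A. s p = v} \<in> sets Q" for v using lev' A(1) by auto
  \<comment> \<open>Only cells in \<open>A' - A\<close> are kept: the jumps in \<open>A\<close>
    cancel in the difference of the two simple sums.\<close>
  define U where "U v = {p \<in> A' - A. s p = v}" for v
  have Ueq: "U v = {p \<in> A'. s p = v} - {p \<in> A. s p = v}" for v by (auto simp: U_def)
  have U: "U v \<in> sets Q" "U v \<subseteq> A' - A" for v
    using lev lev' by (auto simp: Ueq)
  have Udis: "disjoint_family_on U Y" by (auto simp: disjoint_family_on_def U_def)
  have mU: "measure \<mu> (U v) = measure \<mu> {p \<in> A'. s p = v} - measure \<mu> {p \<in> A. s p = v}"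
    if \<mu>: "sets \<mu> = sets Q" "emeasure \<mu> A' < \<infinity>" for \<mu> v
    unfolding Ueq
  proof (rule measure_Diff)
    have "emeasure \<mu> {p \<in> A'. s p = v} \<le> emeasure \<mu> A'"
      using A \<mu> by (intro emeasure_mono) auto
    then show "emeasure \<mu> {p \<in> A'. s p = v} \<noteq> \<infinity>" using \<mu>(2) by (auto simp: top_unique)
  qed (use lev lev' \<mu> A in auto)
  define S where "S \<mu> C = (\<Sum>v\<in>Y. measure \<mu> {p \<in> C. s p = v} *\<^sub>R v)" for \<mu> C
  define X where "X \<omega> = (\<Sum>v\<in>Y. (measure (\<eta> \<omega>) (U v) - measure Q (U v)) *\<^sub>R v)" for \<omega>
  have XS: "X \<omega> = (S (\<eta> \<omega>) A' - S (\<eta> \<omega>) A) - (S Q A' - S Q A)"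
    if "\<omega> \<in> space P" "emeasure (\<eta> \<omega>) A' < \<infinity>" for \<omega>
    unfolding X_def S_def sum_subtractf[symmetric]
    by (intro sum.cong refl) (simp add: mU[OF sets_eta[OF that(1)] that(2)] mU[OF refl A(4)] scaleR_diff_left)
  have cS': "norm (c' - S Q A') \<le> e / 4"
  proof -
    have "ennreal (norm (c' - S Q A')) \<le> (\<integral>\<^sup>+p. ennreal (norm (f p - s p)) \<partial>?R)"
      unfolding S_def
      by (rule bochner_restrict_sum_diff[OF A(2,4) c' Y]) (use lev' in \<open>auto simp: Y_def\<close>)
    also have "\<dots> \<le> ennreal (e / 4)"
      by (rule order.trans[OF s\<beta> ennreal_leI]) (simp add: \<beta>_def)
    finally show ?thesis using e by (simp add: ennreal_le_iff)
  qed
  have cS: "norm (c - S Q A) \<le> e / 4"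
  proof -
    have "ennreal (norm (c - S Q A)) \<le> (\<integral>\<^sup>+p. ennreal (norm (f p - s p)) \<partial>restrict_space Q A)"
      unfolding S_def
      by (rule bochner_restrict_sum_diff[OF A(1) finA c Y]) (use lev A(3) in \<open>auto simp: Y_def\<close>)
    also have "\<dots> = (\<integral>\<^sup>+p. ennreal (norm (f p - s p)) * indicator A p \<partial>Q)"
      using A(1) by (subst nn_integral_restrict_space) auto
    also have "\<dots> \<le> (\<integral>\<^sup>+p. ennreal (norm (f p - s p)) * indicator A' p \<partial>Q)"
      using A(3) by (intro nn_integral_mono) (auto split: split_indicator)
    also have "\<dots> = (\<integral>\<^sup>+p. ennreal (norm (f p - s p)) \<partial>?R)"
      using A(2) by (subst nn_integral_restrict_space) auto
    also have "\<dots> \<le> ennreal (e / 4)"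
      by (rule order.trans[OF s\<beta> ennreal_leI]) (simp add: \<beta>_def)
    finally show ?thesis using e by (simp add: ennreal_le_iff)
  qed
  define N where "N = {p \<in> A'. \<rho> \<le> norm (f p - s p)}"
  have N: "N \<in> sets Q"
  proof -
    have "{p \<in> space ?R. \<rho> \<le> norm (f p - s p)} \<in> sets ?R" using nm by measurable
    then show ?thesis by (simp add: spR setsR N_def)
  qed
  have NA: "emeasure Q N < \<infinity>"
    using emeasure_mono[OF _ A(2), of N] A(4) by (auto simp: N_def intro: le_less_trans)
  have "ennreal (\<rho> * measure Q N) = ennreal \<rho> * emeasure Q N"
    using \<rho> NA by (simp add: emeasure_eq_ennreal_measure ennreal_mult)
  also have "\<dots> = (\<integral>\<^sup>+p. ennreal \<rho> * indicator N p \<partial>?R)"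
    using N by (subst nn_integral_cmult_indicator) (auto simp: setsR eR N_def)
  also have "\<dots> \<le> (\<integral>\<^sup>+p. ennreal (norm (f p - s p)) \<partial>?R)"
    by (intro nn_integral_mono) (auto simp: N_def ennreal_leI split: split_indicator)
  also have "\<dots> \<le> ennreal (\<rho> * (\<theta> / 4))"
    by (rule order.trans[OF s\<beta> ennreal_leI]) (simp add: \<beta>_def)
  finally have mN: "measure Q N \<le> \<theta> / 4"
    using \<rho> \<theta> by (simp add: ennreal_le_iff)
  \<comment> \<open>Closeness of \<open>s\<close> and \<open>f\<close> in mean for \<open>Q\<close>
    becomes closeness at each jump: outside \<open>Bad\<close> there are at most \<open>K\<close>
    jumps, none of them where \<open>s\<close> approximates \<open>f\<close> poorly.\<close>
  define Bad where "Bad = {\<omega> \<in> space P. \<not> emeasure (\<eta> \<omega>) A' \<le> of_nat K} \<union>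
    {\<omega> \<in> space P. emeasure (\<eta> \<omega>) N \<noteq> 0}"
  note [measurable] = borel_measurable_count[OF A(2)] borel_measurable_count[OF N]
  have B1: "{\<omega> \<in> space P. \<not> emeasure (\<eta> \<omega>) A' \<le> of_nat K} \<in> events" by measurable
  have B2: "{\<omega> \<in> space P. emeasure (\<eta> \<omega>) N \<noteq> 0} \<in> events" by measurable
  define h where "h x = norm (\<Sum>v\<in>Y. (enn2real (x v) - measure Q (U v)) *\<^sub>R v)" for x :: "'h \<Rightarrow> ennreal"
  show ?thesis
  proof (rule that[of Y U h Bad])
    show "h \<in> borel_measurable (PiM Y (\<lambda>_. borel))"
    proof -
      \<comment> \<open>Expanding the square avoids vector-valued measurability, which would need a countable base.\<close>
      have "h = (\<lambda>x. sqrt (\<Sum>v\<in>Y. \<Sum>w\<in>Y. (enn2real (x w) - measure Q (U w)) *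
          ((enn2real (x v) - measure Q (U v)) * (v \<bullet> w))))"
        unfolding h_def norm_eq_sqrt_inner inner_sum_left unfolding inner_sum_right by simp
      moreover have "\<dots> \<in> borel_measurable (PiM Y (\<lambda>_. borel))"
        by measurable
      ultimately show ?thesis by (simp only:)
    qed
    show Bad: "Bad \<in> events"
      unfolding Bad_def by (intro sets.Un B1 B2)
    have "prob Bad \<le> prob {\<omega> \<in> space P. \<not> emeasure (\<eta> \<omega>) A' \<le> of_nat K} +
        prob {\<omega> \<in> space P. emeasure (\<eta> \<omega>) N \<noteq> 0}"
      unfolding Bad_def by (intro measure_Un_le B1 B2)
    also have "\<dots> < \<theta> / 2 + \<theta> / 2"
      using K prob_count_nonzero_le[OF N NA] mN \<theta> by simp
    finally show "prob Bad < \<theta>" by simp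
    show "AE \<omega> in P. \<omega> \<notin> Bad \<longrightarrow>
       \<bar>norm (J' \<omega> - J \<omega>) - h (\<lambda>v\<in>Y. emeasure (\<eta> \<omega>) (U v))\<bar> \<le> e"
      using J J' AE_space
    proof eventually_elim
      case (elim \<omega>)
      show ?case
      proof
        assume nb: "\<omega> \<notin> Bad"
        have leK: "emeasure (\<eta> \<omega>) A' \<le> of_nat K" and N0: "emeasure (\<eta> \<omega>) N = 0"
          using nb elim(3) by (auto simp: Bad_def)
        have fin': "emeasure (\<eta> \<omega>) A' < \<infinity>"
          using leK by (rule le_less_trans) (simp add: of_nat_less_top)
        have leK2: "emeasure (\<eta> \<omega>) A \<le> of_nat K"
          using emeasure_mono[OF A(3), of "\<eta> \<omega>"] leK A sets_eta[OF elim(3)] by auto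
        have fin: "emeasure (\<eta> \<omega>) A < \<infinity>"
          using leK2 by (rule le_less_trans) (simp add: of_nat_less_top)
        have mK: "measure (\<eta> \<omega>) C \<le> K" if "emeasure (\<eta> \<omega>) C \<le> of_nat K" for C
          using enn2real_mono[OF that] by (simp add: measure_def of_nat_less_top)
        have "norm (J' \<omega> + c' - S (\<eta> \<omega>) A') \<le> \<rho> * measure (\<eta> \<omega>) A'"
          unfolding S_def
        proof (rule bochner_restrict_sum_diff_bounded[OF _ fin' elim(2) Y, where N=N])
          show "norm (f p - s p) \<le> \<rho>" if "p \<in> A' - N" for p
            using that by (auto simp: N_def)
        qed (use A lev' N N0 \<rho> in \<open>auto simp: Y_def sets_eta[OF elim(3)]\<close>)
        also have "\<dots> \<le> \<rho> * K" using \<rho> mK[OF leK] by simp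
        finally have 1: "norm (J' \<omega> + c' - S (\<eta> \<omega>) A') \<le> e / 4" using \<rho>K by simp
        have "norm (J \<omega> + c - S (\<eta> \<omega>) A) \<le> \<rho> * measure (\<eta> \<omega>) A"
          unfolding S_def
        proof (rule bochner_restrict_sum_diff_bounded[OF _ fin elim(1) Y, where N=N])
          show "norm (f p - s p) \<le> \<rho>" if "p \<in> A - N" for p
            using that A(3) by (auto simp: N_def)
        qed (use A lev N N0 \<rho> in \<open>auto simp: Y_def sets_eta[OF elim(3)]\<close>)
        also have "\<dots> \<le> \<rho> * K" using \<rho> mK[OF leK2] by simp
        finally have 2: "norm (J \<omega> + c - S (\<eta> \<omega>) A) \<le> e / 4" using \<rho>K by simp
        have hX: "h (\<lambda>v\<in>Y. emeasure (\<eta> \<omega>) (U v)) = norm (X \<omega>)"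
          unfolding h_def X_def by (intro arg_cong[where f=norm] sum.cong) (auto simp: measure_def)
        have "(J' \<omega> - J \<omega>) - X \<omega> = (J' \<omega> + c' - S (\<eta> \<omega>) A') - (J \<omega> + c - S (\<eta> \<omega>) A)
            - (c' - S Q A') + (c - S Q A)"
          by (simp add: XS[OF elim(3) fin'])
        then have "norm ((J' \<omega> - J \<omega>) - X \<omega>) \<le> norm (J' \<omega> + c' - S (\<eta> \<omega>) A')
            + norm (J \<omega> + c - S (\<eta> \<omega>) A) + norm (c' - S Q A') + norm (c - S Q A)"
          by (smt (verit) norm_triangle_ineq norm_triangle_ineq4)
        also have "\<dots> \<le> e" using 1 2 cS cS' by simp
        finally show "\<bar>norm (J' \<omega> - J \<omega>) - h (\<lambda>v\<in>Y. emeasure (\<eta> \<omega>) (U v))\<bar> \<le> e"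
          unfolding hX using norm_triangle_ineq3[of "J' \<omega> - J \<omega>" "X \<omega>"] by linarith
      qed
    qed
  qed (use Y U Udis in auto)
qed

end

section \<open>Finiteness of the compensator on jumps above a threshold\<close>

lemma jumps_above_eq: "jumps_above \<epsilon> t = {z. \<epsilon> < \<bar>z\<bar>} \<times> {0<..t}"
  by (auto simp: jumps_above_def)

lemma compensator_Times:
  assumes "sets \<nu> = sets borel" "A \<in> sets borel" "C \<in> sets borel" "C \<subseteq> {0..}"
  shows "A \<times> C \<in> sets (compensator \<nu>)"
    and "emeasure (compensator \<nu>) (A \<times> C) = emeasure \<nu> A * emeasure lborel C"
proof -
  interpret L: sigma_finite_measure "restrict_space lborel {0::real..}"
    by (intro sigma_finite_measure_restrict_space sigma_finite_lborel) simp
  have C: "C \<in> sets (restrict_space lborel {0::real..})"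
    using assms by (subst sets_restrict_space_iff) auto
  show "A \<times> C \<in> sets (compensator \<nu>)"
    unfolding compensator_def using assms C by (intro pair_measureI) auto
  have "emeasure (compensator \<nu>) (A \<times> C) = emeasure \<nu> A * emeasure (restrict_space lborel {0..}) C"
    unfolding compensator_def using assms C by (intro L.emeasure_pair_measure_Times) auto
  also have "emeasure (restrict_space lborel {0..}) C = emeasure lborel C"
    using assms by (intro emeasure_restrict_space) auto
  finally show "emeasure (compensator \<nu>) (A \<times> C) = emeasure \<nu> A * emeasure lborel C" .
qed

lemma sets_jumps_above:
  "sets \<nu> = sets borel \<Longrightarrow> jumps_above \<epsilon> t \<in> sets (compensator \<nu>)"
  unfolding jumps_above_eq by (intro compensator_Times) auto

text \<open>Chebyshev's inequality: \<open>min (z\<^sup>2) 1\<close> is at least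
  \<open>min (\<epsilon>\<^sup>2) 1\<close> on jumps larger than \<epsilon>, and its \<nu>-integral
  is finite.\<close>

lemma emeasure_jumps_above_finite:
  assumes \<nu>: "levy_measure \<nu>" and \<epsilon>: "0 < \<epsilon>"
  shows "emeasure (compensator \<nu>) (jumps_above \<epsilon> t) < \<infinity>"
proof -
  have s: "sets \<nu> = sets borel" and fin: "(\<integral>\<^sup>+z. ennreal (min (z\<^sup>2) 1) \<partial>\<nu>) < \<infinity>"
    using \<nu> by (auto simp: levy_measure_def)
  define m where "m = min (\<epsilon>\<^sup>2) 1"
  have m: "0 < m" using \<epsilon> by (simp add: m_def)
  have "ennreal m * emeasure \<nu> {z. \<epsilon> < \<bar>z\<bar>} = (\<integral>\<^sup>+z. ennreal m * indicator {z. \<epsilon> < \<bar>z\<bar>} z \<partial>\<nu>)"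
    using s by (subst nn_integral_cmult_indicator) auto
  also have "\<dots> \<le> (\<integral>\<^sup>+z. ennreal (min (z\<^sup>2) 1) \<partial>\<nu>)"
  proof (rule nn_integral_mono)
    fix z
    have "m \<le> min (z\<^sup>2) 1" if "\<epsilon> < \<bar>z\<bar>"
      using that \<epsilon> power_mono[of \<epsilon> "\<bar>z\<bar>" 2] by (auto simp: m_def)
    then show "ennreal m * indicator {z. \<epsilon> < \<bar>z\<bar>} z \<le> ennreal (min (z\<^sup>2) 1)"
      by (auto split: split_indicator intro!: ennreal_leI)
  qed
  finally have "ennreal m * emeasure \<nu> {z. \<epsilon> < \<bar>z\<bar>} < \<infinity>"
    using fin by (rule le_less_trans)
  then have "emeasure \<nu> {z. \<epsilon> < \<bar>z\<bar>} < \<infinity>"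
    using m by (auto simp: ennreal_mult_less_top)
  moreover have "emeasure lborel {0<..t} < \<infinity>"
    by (cases "0 \<le> t") auto
  moreover have "emeasure (compensator \<nu>) (jumps_above \<epsilon> t) = emeasure \<nu> {z. \<epsilon> < \<bar>z\<bar>} * emeasure lborel {0<..t}"
    unfolding jumps_above_eq by (rule compensator_Times(2)) (use s in auto)
  ultimately show ?thesis by (simp add: ennreal_mult_less_top)
qed

text \<open>The essential range of \<open>f\<close> on \<open>A\<close>. The pointwise range would
  carry no information, because the integrand \<Phi> is prescribed only almost everywhere.\<close>

definition essential_values :: "'p measure \<Rightarrow> 'p set \<Rightarrow> ('p \<Rightarrow> 'b::real_normed_vector) \<Rightarrow> 'b set" where
  "essential_values M A f = {v. \<forall>\<rho>>0. 0 < emeasure M {p \<in> A. norm (f p - v) < \<rho>}}"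

section \<open>Small-ball probability for a compensated integral\<close>

context poisson_measure
begin

text \<open>\<open>x + Z\<close> splits into the error of realising \<open>sum_list l\<close> by
  large jumps, the error of approximating \<open>c \<epsilon> - x\<close> by
  \<open>sum_list l\<close>, and minus the remainder \<open>J \<epsilon> - Z\<close>. The event
  \<open>G\<close> controls the first, \<open>dense\<close> the second. The remainder cannot be
  large on all of \<open>G\<close>, being nearly independent of it.\<close>

lemma compensated_integral_small_ball:
  fixes \<Phi> :: "real \<times> real \<Rightarrow> 'h::real_inner"
  assumes \<nu>: "levy_measure \<nu>" and Z: "has_compensated_integral P \<nu> \<eta> t \<Phi> Z"
    and "0 < \<epsilon>0" and \<delta>: "0 < \<delta>"
    and dense: "\<And>\<epsilon> c. 0 < \<epsilon> \<Longrightarrow> \<epsilon> < \<epsilon>0 \<Longrightarrow> bochner (restrict_space Q (jumps_above \<epsilon> t)) \<Phi> c \<Longrightarrow>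
      c - x \<in> closure {sum_list l | l. set l \<subseteq> essential_values Q (jumps_above \<epsilon> t) \<Phi>}"
  shows "\<exists>E\<in>events. 0 < prob E \<and> (AE \<omega> in P. \<omega> \<in> E \<longrightarrow> norm (x + Z \<omega>) \<le> \<delta>)"
proof -
  have s\<nu>: "sets \<nu> = sets borel" using \<nu> by (simp add: levy_measure_def)
  from Z[unfolded has_compensated_integral_def] obtain J c where Jc:
    "(\<forall>\<epsilon>>0. bochner (restrict_space Q (jumps_above \<epsilon> t)) \<Phi> (c \<epsilon>) \<and>
       (AE \<omega> in P. bochner (restrict_space (\<eta> \<omega>) (jumps_above \<epsilon> t)) \<Phi> (J \<epsilon> \<omega> + c \<epsilon>)) \<and>
       (\<lambda>\<omega>. norm (J \<epsilon> \<omega> - Z \<omega>)) \<in> borel_measurable P) \<and>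
     (\<forall>a>0. ((\<lambda>\<epsilon>. prob {\<omega>\<in>space P. a < norm (J \<epsilon> \<omega> - Z \<omega>)}) \<longlongrightarrow> 0) (at_right 0))"
    by (elim exE) (rule that)
  note c = Jc[THEN conjunct1, rule_format, THEN conjunct1]
    and J = Jc[THEN conjunct1, rule_format, THEN conjunct2, THEN conjunct1]
    and m = Jc[THEN conjunct1, rule_format, THEN conjunct2, THEN conjunct2]
    and lim = Jc[THEN conjunct2, rule_format]
  \<comment> \<open>The three errors will add up to \<open>7 * a\<close>.\<close>
  define a where "a = \<delta> / 10"
  have a: "0 < a" using \<delta> by (simp add: a_def)
  define Far where "Far b \<epsilon> = {\<omega>\<in>space P. b < norm (J \<epsilon> \<omega> - Z \<omega>)}" for b \<epsilon>
  have Far: "Far b \<epsilon> \<in> events" if "0 < \<epsilon>" for b \<epsilon>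
    using m[OF that] unfolding Far_def by measurable
  have ex: "\<exists>\<epsilon>>0. \<epsilon> < r \<and> prob (Far a \<epsilon>) < q" if "0 < r" "0 < q" for r q
  proof -
    have "eventually (\<lambda>\<epsilon>. prob (Far a \<epsilon>) < q) (at_right 0)"
      unfolding Far_def by (rule order_tendstoD[OF lim[OF a]]) (rule that)
    moreover have "eventually (\<lambda>\<epsilon>::real. 0 < \<epsilon> \<and> \<epsilon> < r) (at_right 0)"
      using that by (auto simp: eventually_at_right_field)
    ultimately have "eventually (\<lambda>\<epsilon>. 0 < \<epsilon> \<and> \<epsilon> < r \<and> prob (Far a \<epsilon>) < q) (at_right 0)"
      by eventually_elim auto
    then show ?thesis
      using eventually_happens'[of "at_right (0::real)"] by auto
  qed
  \<comment> \<open>The bound \<open>1 / 4\<close>, together with two exceptional events of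
    probability below \<open>1 / 8\<close>, will give \<open>prob XL < 1 / 2\<close>.\<close>
  obtain \<epsilon> where \<epsilon>: "0 < \<epsilon>" "\<epsilon> < \<epsilon>0" and Fe: "prob (Far a \<epsilon>) < 1 / 4"
    using ex[OF \<open>0 < \<epsilon>0\<close>, of "1/4"] by auto
  let ?A = "jumps_above \<epsilon> t"
  obtain l where l: "set l \<subseteq> essential_values Q ?A \<Phi>" and lx: "dist (sum_list l) (c \<epsilon> - x) < a"
    using dense[OF \<epsilon> c[OF \<epsilon>(1)]] a unfolding closure_approachable by auto
  have \<Phi>m: "\<Phi> \<in> borel_measurable (restrict_space Q ?A)"
    using c[OF \<epsilon>(1)] by (simp add: bochner_def)
  obtain V :: "'h option \<Rightarrow> (real \<times> real) set" and n I where
    I: "finite I" "I \<noteq> {}" and V: "\<And>i. i \<in> I \<Longrightarrow> V i \<in> sets Q" "\<And>i. i \<in> I \<Longrightarrow> V i \<subseteq> ?A"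
    and Vdis: "disjoint_family_on V I" and Vpos: "\<And>i. i \<in> I \<Longrightarrow> n i = 0 \<or> 0 < emeasure Q (V i)"
    and Vl: "\<And>\<mu> y. sets \<mu> = sets Q \<Longrightarrow> (\<And>i. i \<in> I \<Longrightarrow> emeasure \<mu> (V i) = of_nat (n i)) \<Longrightarrow>
       bochner (restrict_space \<mu> ?A) \<Phi> y \<Longrightarrow> norm (y - sum_list l) \<le> a"
    by (rule jump_configuration[OF sets_jumps_above[OF s\<nu>] \<Phi>m _ a, of l])
      (use l in \<open>auto simp: essential_values_def\<close>)
  define G where "G = {\<omega> \<in> space P. \<forall>i\<in>I. emeasure (\<eta> \<omega>) (V i) = of_nat (n i)}"
  have finV: "emeasure Q (V i) < \<infinity>" if "i \<in> I" for i
    using emeasure_mono[OF V(2)[OF that] sets_jumps_above[OF s\<nu>]] emeasure_jumps_above_finite[OF \<nu> \<epsilon>(1)]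
    by (rule le_less_trans)
  have G: "G \<in> events" "0 < prob G"
    unfolding G_def using prob_counts_pos[OF I V(1) Vdis finV Vpos] by auto
  \<comment> \<open>The exceptional events must be small against \<open>prob G\<close>, since
    \<open>prob G / 2 + 2 * \<theta>\<close> has to stay below \<open>prob G\<close>.\<close>
  define \<theta> where "\<theta> = prob G / 8"
  have \<theta>: "0 < \<theta>" "\<theta> \<le> 1 / 8" using G prob_le_1[of G] by (auto simp: \<theta>_def)
  obtain \<epsilon>' where \<epsilon>': "0 < \<epsilon>'" "\<epsilon>' < \<epsilon>" and Fe': "prob (Far a \<epsilon>') < \<theta>"
    using ex[OF \<epsilon>(1) \<theta>(1)] by auto
  let ?A' = "jumps_above \<epsilon>' t"
  have AA': "?A \<subseteq> ?A'" using \<epsilon>' by (auto simp: jumps_above_def)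
  obtain Y :: "'h set" and U h Bad where
    Y: "finite Y" and U: "\<And>v. v \<in> Y \<Longrightarrow> U v \<in> sets Q" "\<And>v. v \<in> Y \<Longrightarrow> U v \<subseteq> ?A' - ?A"
    and Udis: "disjoint_family_on U Y" and h: "h \<in> borel_measurable (PiM Y (\<lambda>_. borel))"
    and Bad: "Bad \<in> events" "prob Bad < \<theta>"
    and near: "AE \<omega> in P. \<omega> \<notin> Bad \<longrightarrow>
       \<bar>norm (J \<epsilon>' \<omega> - J \<epsilon> \<omega>) - h (\<lambda>v\<in>Y. emeasure (\<eta> \<omega>) (U v))\<bar> \<le> a"
    by (rule compensated_difference_approx[OF sets_jumps_above[OF s\<nu>] sets_jumps_above[OF s\<nu>] AA'
          emeasure_jumps_above_finite[OF \<nu> \<epsilon>'(1)] c[OF \<epsilon>'(1)] c[OF \<epsilon>(1)] J[OF \<epsilon>'(1)] J[OF \<epsilon>(1)] a \<theta>(1)])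
      blast
  define X where "X \<omega> = h (\<lambda>v\<in>Y. emeasure (\<eta> \<omega>) (U v))" for \<omega>
  \<comment> \<open>Both families are put on one sum type, so that their joint independence is a
    single instance of independence of counts.\<close>
  define W where "W = case_sum V U"
  define h' where "h' x = h (\<lambda>v\<in>Y. x (Inr v))" for x :: "'h option + 'h \<Rightarrow> ennreal"
  have IY: "finite (Inl ` I :: ('h option + 'h) set)" "finite (Inr ` Y :: ('h option + 'h) set)"
    "(Inl ` I :: ('h option + 'h) set) \<noteq> {}" "Inl ` I \<inter> Inr ` Y = {}"
    using I Y by auto
  have W: "W i \<in> sets Q" if "i \<in> Inl ` I \<union> Inr ` Y" for i
    using that U V by (auto simp: W_def)
  have Wdis: "disjoint_family_on W (Inl ` I \<union> Inr ` Y)"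
    unfolding disjoint_family_on_def
  proof (intro ballI impI)
    fix i j assume ij: "i \<in> Inl ` I \<union> Inr ` Y" "j \<in> Inl ` I \<union> Inr ` Y" "i \<noteq> j"
    have "V i \<inter> U v = {}" if "i \<in> I" "v \<in> Y" for i v
      using that U(2) V(2) by blast
    with ij Vdis Udis show "W i \<inter> W j = {}"
      by (auto simp: W_def disjoint_family_on_def) blast+
  qed
  have h': "h' \<in> borel_measurable (PiM (Inr ` Y) (\<lambda>_. borel))"
    unfolding h'_def
    by (rule measurable_compose[OF measurable_restrict h]) (rule measurable_component_singleton, simp)
  have X': "h' (\<lambda>i\<in>Inr ` Y. emeasure (\<eta> \<omega>) (W i)) = X \<omega>" for \<omega>
    unfolding h'_def X_def by (intro arg_cong[where f=h]) (auto simp: W_def fun_eq_iff)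
  have G': "{\<omega> \<in> space P. \<forall>i\<in>Inl ` I. emeasure (\<eta> \<omega>) (W i) = of_nat (case_sum n (\<lambda>_. 0) i)} = G"
    by (auto simp: G_def W_def)
  have Xm: "X \<in> borel_measurable P"
    and Xind: "prob (G \<inter> {\<omega> \<in> space P. 3 * a < X \<omega>}) = prob G * prob {\<omega> \<in> space P. 3 * a < X \<omega>}"
    using prob_counts_indep(1)[OF IY(1,2,3,4) W Wdis h']
      prob_counts_indep(2)[OF IY(1,2,3,4) W Wdis h', of "case_sum n (\<lambda>_. 0)" "3 * a"]
    unfolding X' G' by auto
  define XL where "XL = {\<omega> \<in> space P. 3 * a < X \<omega>}"
  have XL: "XL \<in> events" using Xm unfolding XL_def by measurable
  have tri: "norm (J \<epsilon>' \<omega> - J \<epsilon> \<omega>) \<le> norm (J \<epsilon>' \<omega> - Z \<omega>) + norm (J \<epsilon> \<omega> - Z \<omega>)"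
    "norm (J \<epsilon> \<omega> - Z \<omega>) \<le> norm (J \<epsilon>' \<omega> - Z \<omega>) + norm (J \<epsilon>' \<omega> - J \<epsilon> \<omega>)" for \<omega>
    using norm_triangle_ineq4[of "J \<epsilon>' \<omega> - Z \<omega>" "J \<epsilon> \<omega> - Z \<omega>"]
      norm_triangle_ineq4[of "J \<epsilon>' \<omega> - Z \<omega>" "J \<epsilon>' \<omega> - J \<epsilon> \<omega>"] by auto
  \<comment> \<open>If \<open>X \<omega> > 3 * a\<close> outside \<open>Bad\<close>, then
    \<open>J \<epsilon>' \<omega>\<close> and \<open>J \<epsilon> \<omega>\<close> are more than
    \<open>2 * a\<close> apart, so one of them is more than \<open>a\<close> away from
    \<open>Z \<omega>\<close>.\<close>
  have "prob XL \<le> prob (Far a \<epsilon> \<union> (Far a \<epsilon>' \<union> Bad))"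
  proof (rule finite_measure_mono_AE)
    show "AE \<omega> in P. \<omega> \<in> XL \<longrightarrow> \<omega> \<in> Far a \<epsilon> \<union> (Far a \<epsilon>' \<union> Bad)"
      using near
    proof eventually_elim
      case (elim \<omega>)
      then show ?case
        using tri(1)[of \<omega>] by (auto simp: XL_def Far_def X_def abs_le_iff)
    qed
  qed (use Far Bad \<epsilon>(1) \<epsilon>'(1) in auto)
  also have "\<dots> \<le> prob (Far a \<epsilon>) + (prob (Far a \<epsilon>') + prob Bad)"
    using Far Bad \<epsilon>(1) \<epsilon>'(1)
    by (intro order.trans[OF measure_Un_le] add_left_mono measure_Un_le) auto
  also have "\<dots> < 1 / 2" using Fe Fe' Bad \<theta> by simp
  finally have XL2: "prob XL < 1 / 2" .
  \<comment> \<open>If \<open>J \<epsilon> \<omega>\<close> is more than \<open>5 * a\<close> from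
    \<open>Z \<omega>\<close> while \<open>J \<epsilon>' \<omega>\<close> is within \<open>a\<close>
    of it, the two differ by more than \<open>4 * a\<close>; outside \<open>Bad\<close> this forces
    \<open>X \<omega> > 3 * a\<close>.\<close>
  have "prob (G \<inter> Far (5 * a) \<epsilon>) \<le> prob ((G \<inter> XL) \<union> (Far a \<epsilon>' \<union> Bad))"
  proof (rule finite_measure_mono_AE)
    show "AE \<omega> in P. \<omega> \<in> G \<inter> Far (5 * a) \<epsilon> \<longrightarrow> \<omega> \<in> (G \<inter> XL) \<union> (Far a \<epsilon>' \<union> Bad)"
      using near
    proof eventually_elim
      case (elim \<omega>)
      then show ?case
        using tri(2)[of \<omega>] by (auto simp: XL_def Far_def X_def abs_le_iff)
    qed
  qed (use Far Bad G XL \<epsilon>(1) \<epsilon>'(1) in auto)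
  also have "\<dots> \<le> prob (G \<inter> XL) + (prob (Far a \<epsilon>') + prob Bad)"
    using Far Bad G XL \<epsilon>'(1)
    by (intro order.trans[OF measure_Un_le] add_left_mono measure_Un_le) auto
  also have "prob (G \<inter> XL) \<le> prob G * (1 / 2)"
    unfolding XL_def Xind using XL2 G by (intro mult_left_mono) (auto simp: XL_def)
  also have "prob G * (1 / 2) + (prob (Far a \<epsilon>') + prob Bad) < prob G"
    using Fe' Bad G by (simp add: \<theta>_def)
  finally have lt: "prob (G \<inter> Far (5 * a) \<epsilon>) < prob G" by simp
  define E where "E = G - Far (5 * a) \<epsilon>"
  show ?thesis
  proof (intro bexI conjI)
    show "E \<in> events" unfolding E_def using G Far \<epsilon> by auto
    have "prob E = prob G - prob (G \<inter> Far (5 * a) \<epsilon>)"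
      unfolding E_def using G Far[OF \<epsilon>(1)] by (subst finite_measure_Diff'[symmetric]) auto
    then show "0 < prob E" using lt by simp
    show "AE \<omega> in P. \<omega> \<in> E \<longrightarrow> norm (x + Z \<omega>) \<le> \<delta>"
      using J[OF \<epsilon>(1)] AE_space
    proof eventually_elim
      case (elim \<omega>)
      show ?case
      proof
        assume "\<omega> \<in> E"
        then have \<omega>: "\<And>i. i \<in> I \<Longrightarrow> emeasure (\<eta> \<omega>) (V i) = of_nat (n i)"
          "norm (J \<epsilon> \<omega> - Z \<omega>) \<le> 5 * a"
          using elim(2) by (auto simp: E_def G_def Far_def)
        have 1: "norm (J \<epsilon> \<omega> + c \<epsilon> - sum_list l) \<le> a"
          by (rule Vl[OF sets_eta[OF elim(2)] \<omega>(1) elim(1)])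
        have 2: "norm (sum_list l - (c \<epsilon> - x)) \<le> a" using lx by (simp add: dist_norm)
        have "x + Z \<omega> = (J \<epsilon> \<omega> + c \<epsilon> - sum_list l) + (sum_list l - (c \<epsilon> - x)) - (J \<epsilon> \<omega> - Z \<omega>)"
          by simp
        also have "norm \<dots> \<le> a + a + 5 * a"
          by (intro order.trans[OF norm_triangle_ineq4] add_mono order.trans[OF norm_triangle_ineq] 1 2 \<omega>(2))
        finally show "norm (x + Z \<omega>) \<le> \<delta>" using \<delta> by (simp add: a_def)
      qed
    qed
  qed
qed

end

subsection \<open>Integrals with a scalar weight\<close>

lemma weighted_has_integral_diff_le:
  fixes G H :: "real \<Rightarrow> 'b::banach"
  assumes "((\<lambda>s. v s *\<^sub>R G s) has_integral Y) {0..T}" "((\<lambda>s. v s *\<^sub>R H s) has_integral Z) {0..T}"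
    and v: "v absolutely_integrable_on {0..T::real}"
    and \<theta>: "\<And>s. s \<in> {0..T} \<Longrightarrow> norm (G s - H s) \<le> \<theta>"
  shows "norm (Y - Z) \<le> \<theta> * integral {0..T} (\<lambda>s. \<bar>v s\<bar>)"
proof -
  have d: "((\<lambda>s. v s *\<^sub>R G s - v s *\<^sub>R H s) has_integral (Y - Z)) {0..T}"
    by (rule has_integral_diff[OF assms(1,2)])
  have av: "(\<lambda>s. \<bar>v s\<bar>) integrable_on {0..T}"
    using v unfolding absolutely_integrable_on_def by simp
  have "norm (integral {0..T} (\<lambda>s. v s *\<^sub>R G s - v s *\<^sub>R H s)) \<le> integral {0..T} (\<lambda>s. \<theta> * \<bar>v s\<bar>)"
  proof (rule integral_norm_bound_integral)
    show "norm (v s *\<^sub>R G s - v s *\<^sub>R H s) \<le> \<theta> * \<bar>v s\<bar>" if "s \<in> {0..T}" for s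
      using mult_left_mono[OF \<theta>[OF that], of "\<bar>v s\<bar>"]
      by (simp add: scaleR_diff_right[symmetric] mult.commute)
  qed (use d integrable_cmul[OF av, of \<theta>] in \<open>auto simp: has_integral_integrable\<close>)
  then show ?thesis using integral_unique[OF d] by simp
qed

lemma infdist_scaleR_le:
  fixes V :: "'b::real_normed_vector set"
  assumes "subspace V"
  shows "infdist (c *\<^sub>R x) V \<le> \<bar>c\<bar> * infdist x V"
proof -
  have "infdist (- x) V \<le> infdist x V" for x
  proof -
    have ne: "V \<noteq> {}" using assms subspace_0 by auto
    have "infdist (- x) V \<le> dist x a" if "a \<in> V" for a
    proof -
      have "- a \<in> V" by (rule subspace_neg[OF assms that])
      then have "infdist (- x) V \<le> dist (- x) (- a)" by (rule infdist_le)
      then show ?thesis by (simp add: dist_minus)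
    qed
    then show ?thesis unfolding infdist_notempty[OF ne, of x] by (intro cINF_greatest ne)
  qed
  \<comment> \<open>The sign of \<open>c\<close> is moved into the vector because the sublinearity
    estimate, used here for a one-term sum, needs nonnegative coefficients.\<close>
  moreover have "infdist (c *\<^sub>R x) V = infdist (\<Sum>y\<in>{()}. \<bar>c\<bar> *\<^sub>R (sgn c *\<^sub>R x)) V"
    by (simp add: abs_mult_sgn)
  moreover have "\<dots> \<le> (\<Sum>y\<in>{()}. \<bar>c\<bar> * infdist (sgn c *\<^sub>R x) V)"
    by (rule infdist_subspace_sum[OF assms]) simp
  ultimately show ?thesis
    using subspace_0[OF assms] by (cases c "0::real" rule: linorder_cases) (auto intro: order.trans mult_left_mono)
qed

lemma weighted_step_approximation:
  fixes g :: "real \<Rightarrow> 'b::banach"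
  assumes T: "0 < T" and v: "v absolutely_integrable_on {0..T}" and g: "continuous_on {0..T} g"
    and V: "subspace V" and d: "\<And>s. s \<in> {0..T} \<Longrightarrow> infdist (g s) V \<le> d" and \<theta>: "0 < \<theta>"
  obtains G Y where "\<And>s. s \<in> {0..T} \<Longrightarrow> norm (g s - G s) \<le> \<theta>"
    "((\<lambda>s. v s *\<^sub>R G s) has_integral Y) {0..T}"
    "infdist Y V \<le> d * integral {0..T} (\<lambda>s. \<bar>v s\<bar>)"
proof -
  have "uniformly_continuous_on {0..T} g"
    by (rule compact_uniformly_continuous[OF g]) simp
  then obtain \<beta> where \<beta>: "0 < \<beta>"
    "\<And>s t. s \<in> {0..T} \<Longrightarrow> t \<in> {0..T} \<Longrightarrow> dist t s < \<beta> \<Longrightarrow> dist (g t) (g s) < \<theta>"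
    unfolding uniformly_continuous_on_def using \<theta> by metis
  define h where "h = \<beta> / 2"
  have h: "0 < h" using \<beta> by (simp add: h_def)
  define fl where "fl s = h * \<lfloor>s / h\<rfloor>" for s
  define n where "n = \<lfloor>T / h\<rfloor>"
  have fl: "0 \<le> fl s" "fl s \<le> s" "s - fl s < h" if "0 \<le> s" for s
  proof -
    have "0 \<le> \<lfloor>s / h\<rfloor>" using that h by simp
    then show "0 \<le> fl s" using h by (simp add: fl_def)
    have "h * \<lfloor>s / h\<rfloor> \<le> h * (s / h)" using h by (intro mult_left_mono) auto
    then show "fl s \<le> s" using h by (simp add: fl_def)
    have "h * (s / h) < h * (\<lfloor>s / h\<rfloor> + 1)" using h by (intro mult_strict_left_mono) linarith+
    then show "s - fl s < h" using h by (simp add: fl_def distrib_left)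
  qed
  define I where "I j = {s \<in> {0..T}. \<lfloor>s / h\<rfloor> = j}" for j
  have Ileb: "I j \<in> sets lebesgue" for j
  proof -
    have "{s \<in> space borel. \<lfloor>s / h\<rfloor> = j} \<in> sets borel" by measurable
    moreover have "I j = {s \<in> space borel. \<lfloor>s / h\<rfloor> = j} \<inter> {0..T}" by (auto simp: I_def)
    ultimately have "I j \<in> sets borel" by auto
    then show ?thesis by (simp add: sets_completionI_sets)
  qed
  have vI: "v absolutely_integrable_on I j" for j
    by (rule set_integrable_subset[OF v Ileb]) (auto simp: I_def)
  have hasI: "((\<lambda>s. if s \<in> I j then u s else 0) has_integral integral (I j) u) {0..T}"
    if "u integrable_on I j" for u :: "real \<Rightarrow> real" and j
  proof -
    have "I j \<subseteq> {0..T}" by (auto simp: I_def)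
    then show ?thesis using that by (subst has_integral_restrict) (auto intro: integrable_integral)
  qed
  have part: "(\<Sum>j\<in>{0..n}. (if s \<in> I j then f j else 0)) = f \<lfloor>s / h\<rfloor>" if "s \<in> {0..T}"
    for s and f :: "int \<Rightarrow> 'c::comm_monoid_add"
  proof -
    have "\<lfloor>s / h\<rfloor> \<in> {0..n}" using that h by (auto simp: n_def intro!: floor_mono divide_right_mono)
    moreover have "(\<Sum>j\<in>{0..n}. (if s \<in> I j then f j else 0)) = (\<Sum>j\<in>{0..n}. (if \<lfloor>s / h\<rfloor> = j then f j else 0))"
      using that by (intro sum.cong) (auto simp: I_def)
    ultimately show ?thesis by simp
  qed
  \<comment> \<open>A nonempty cell contains a point with left grid point \<open>h * j\<close>,
    which places \<open>h * j\<close> in \<open>{0..T}\<close>; the default \<open>0\<close>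
    disposes of empty cells.\<close>
  define Y where "Y = (\<Sum>j\<in>{0..n}. integral (I j) v *\<^sub>R (if I j = {} then 0 else g (h * j)))"
  have 1: "norm (g s - g (fl s)) \<le> \<theta>" if s: "s \<in> {0..T}" for s
  proof -
    have "0 \<le> fl s" "fl s \<le> s" "s - fl s < h" using fl[of s] s by auto
    then have "dist (g s) (g (fl s)) < \<theta>"
      using s \<beta>(1) by (intro \<beta>(2)) (auto simp: dist_real_def h_def)
    then show ?thesis by (simp add: dist_norm)
  qed
  have "((\<lambda>s. \<Sum>j\<in>{0..n}. (if s \<in> I j then v s else 0) *\<^sub>R (if I j = {} then 0 else g (h * j))) has_integral Y) {0..T}"
    unfolding Y_def
    by (intro has_integral_sum has_integral_scaleR_left hasI)
      (use vI in \<open>auto simp: absolutely_integrable_on_def\<close>)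
  moreover have "(\<Sum>j\<in>{0..n}. (if s \<in> I j then v s else 0) *\<^sub>R (if I j = {} then 0 else g (h * j))) = v s *\<^sub>R g (fl s)"
    if "s \<in> {0..T}" for s
  proof -
    have "(\<Sum>j\<in>{0..n}. (if s \<in> I j then v s else 0) *\<^sub>R (if I j = {} then 0 else g (h * j)))
        = (\<Sum>j\<in>{0..n}. (if s \<in> I j then v s *\<^sub>R g (h * j) else 0))"
      by (intro sum.cong) auto
    then show ?thesis using part[OF that, of "\<lambda>j. v s *\<^sub>R g (h * j)"] by (simp add: fl_def)
  qed
  ultimately have 2: "((\<lambda>s. v s *\<^sub>R g (fl s)) has_integral Y) {0..T}"
    by (rule has_integral_eq[rotated])
  have d0: "0 \<le> d" using d[of 0] T infdist_nonneg[of "g 0" V] by simp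
  have avI: "(\<lambda>s. \<bar>v s\<bar>) integrable_on I j" for j
    using vI[of j] by (simp add: absolutely_integrable_on_def)
  have "infdist Y V \<le> (\<Sum>j\<in>{0..n}. 1 * infdist (integral (I j) v *\<^sub>R (if I j = {} then 0 else g (h * j))) V)"
    unfolding Y_def using infdist_subspace_sum[OF V, of "{0..n}" "\<lambda>_. 1"] by simp
  also have "\<dots> \<le> (\<Sum>j\<in>{0..n}. integral (I j) (\<lambda>s. \<bar>v s\<bar>) * d)"
  proof (rule sum_mono)
    fix j
    have "infdist (if I j = {} then 0 else g (h * j)) V \<le> d"
    proof (cases "I j = {}")
      case False
      then obtain s where "s \<in> {0..T}" "\<lfloor>s / h\<rfloor> = j" by (auto simp: I_def)
      then have "h * j \<in> {0..T}" using fl[of s] by (auto simp: fl_def)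
      then show ?thesis using d False by simp
    qed (use d0 subspace_0[OF V] in auto)
    moreover have "\<bar>integral (I j) v\<bar> \<le> integral (I j) (\<lambda>s. \<bar>v s\<bar>)"
      using integral_norm_bound_integral[of v "I j" "\<lambda>s. \<bar>v s\<bar>"] vI[of j] avI[of j]
      by (simp add: absolutely_integrable_on_def)
    ultimately show "1 * infdist (integral (I j) v *\<^sub>R (if I j = {} then 0 else g (h * j))) V
        \<le> integral (I j) (\<lambda>s. \<bar>v s\<bar>) * d"
      using infdist_scaleR_le[OF V, of "integral (I j) v" "if I j = {} then 0 else g (h * j)"]
        mult_mono[of "\<bar>integral (I j) v\<bar>" "integral (I j) (\<lambda>s. \<bar>v s\<bar>)"] infdist_nonneg
      by (smt (verit) abs_ge_zero mult_1)
  qed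
  also have "\<dots> = d * (\<Sum>j\<in>{0..n}. integral (I j) (\<lambda>s. \<bar>v s\<bar>))"
    by (simp add: sum_distrib_left mult.commute)
  also have "(\<Sum>j\<in>{0..n}. integral (I j) (\<lambda>s. \<bar>v s\<bar>)) = integral {0..T} (\<lambda>s. \<bar>v s\<bar>)"
  proof -
    have "((\<lambda>s. \<Sum>j\<in>{0..n}. (if s \<in> I j then \<bar>v s\<bar> else 0)) has_integral
        (\<Sum>j\<in>{0..n}. integral (I j) (\<lambda>s. \<bar>v s\<bar>))) {0..T}"
      by (intro has_integral_sum hasI avI) simp
    then have "((\<lambda>s. \<bar>v s\<bar>) has_integral (\<Sum>j\<in>{0..n}. integral (I j) (\<lambda>s. \<bar>v s\<bar>))) {0..T}"
      by (rule has_integral_eq[rotated]) (rule part)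
    then show ?thesis by (rule integral_unique[symmetric])
  qed
  finally have 3: "infdist Y V \<le> d * integral {0..T} (\<lambda>s. \<bar>v s\<bar>)" .
  show ?thesis by (rule that[OF 1 2 3])
qed

text \<open>The weighted integral is only known to exist in the larger space \<open>'e\<close>; its step function
  approximations are Cauchy already in \<open>'b\<close>.\<close>

lemma weighted_integral_infdist:
  fixes g :: "real \<Rightarrow> 'b::banach" and \<iota> :: "'b \<Rightarrow> 'e::banach"
  assumes T: "0 < T" and v: "v absolutely_integrable_on {0..T}" and g: "continuous_on {0..T} g"
    and \<iota>: "bounded_linear \<iota>" "inj \<iota>"
    and y: "((\<lambda>s. v s *\<^sub>R \<iota> (g s)) has_integral \<iota> y) {0..T}"
    and V: "subspace V" and d: "\<And>s. s \<in> {0..T} \<Longrightarrow> infdist (g s) V \<le> d"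
  shows "infdist y V \<le> d * integral {0..T} (\<lambda>s. \<bar>v s\<bar>)"
proof -
  interpret \<iota>: bounded_linear \<iota> by fact
  define N where "N = integral {0..T} (\<lambda>s. \<bar>v s\<bar>)"
  define \<theta> where "\<theta> n = inverse (real (Suc n))" for n
  have \<theta>: "0 < \<theta> n" for n by (simp add: \<theta>_def)
  have \<theta>0: "\<theta> \<longlonglongrightarrow> 0" unfolding \<theta>_def[abs_def] by (rule LIMSEQ_inverse_real_of_nat)
  have "\<exists>G Y. (\<forall>s\<in>{0..T}. norm (g s - G s) \<le> \<theta> n) \<and>
    ((\<lambda>s. v s *\<^sub>R G s) has_integral Y) {0..T} \<and> infdist Y V \<le> d * N" for n
    unfolding N_def by (rule weighted_step_approximation[OF T v g V d \<theta>[of n]]) blast+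
  then obtain G Y where G: "\<And>n s. s \<in> {0..T} \<Longrightarrow> norm (g s - G n s) \<le> \<theta> n"
    and Y: "\<And>n. ((\<lambda>s. v s *\<^sub>R G n s) has_integral Y n) {0..T}" and YV: "\<And>n. infdist (Y n) V \<le> d * N"
    by metis
  have YY: "norm (Y m - Y n) \<le> (\<theta> m + \<theta> n) * N" for m n
    unfolding N_def
  proof (rule weighted_has_integral_diff_le[OF Y Y v])
    fix s assume s: "s \<in> {0..T}"
    show "norm (G m s - G n s) \<le> \<theta> m + \<theta> n"
      using norm_triangle_ineq4[of "g s - G n s" "g s - G m s"] G[OF s, of m] G[OF s, of n] by simp
  qed
  have "Cauchy Y"
  proof (rule metric_CauchyI)
    fix e :: real assume e: "0 < e"
    have "(\<lambda>n. \<theta> n * N) \<longlonglongrightarrow> 0 * N" by (intro tendsto_intros \<theta>0)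
    then have "eventually (\<lambda>n. \<theta> n * N < e / 2) sequentially"
      by (rule order_tendstoD) (use e in simp)
    then obtain M where M: "\<And>n. M \<le> n \<Longrightarrow> \<theta> n * N < e / 2"
      by (auto simp: eventually_sequentially)
    show "\<exists>M. \<forall>m\<ge>M. \<forall>n\<ge>M. dist (Y m) (Y n) < e"
    proof (intro exI allI impI)
      fix m n assume "M \<le> m" "M \<le> n"
      then show "dist (Y m) (Y n) < e"
        using YY[of m n] M[of m] M[of n] by (simp add: dist_norm distrib_right)
    qed
  qed
  then obtain Z where Z: "Y \<longlonglongrightarrow> Z"
    by (auto simp: Cauchy_convergent_iff convergent_def)
  \<comment> \<open>The limit \<open>Z\<close> is found in \<open>'b\<close>; comparing images under
    the continuous injective map \<iota> identifies it with \<open>y\<close>.\<close>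
  obtain K where K: "0 < K" "\<And>x. norm (\<iota> x) \<le> norm x * K" using \<iota>.pos_bounded by auto
  have "norm (\<iota> (Y n) - \<iota> y) \<le> (K * \<theta> n) * N" for n
    unfolding N_def
  proof (rule weighted_has_integral_diff_le[OF _ y v])
    show "((\<lambda>s. v s *\<^sub>R \<iota> (G n s)) has_integral \<iota> (Y n)) {0..T}"
      using has_integral_linear[OF Y \<iota>(1)] by (simp add: o_def \<iota>.scaleR)
    fix s assume s: "s \<in> {0..T}"
    show "norm (\<iota> (G n s) - \<iota> (g s)) \<le> K * \<theta> n"
    proof -
      have "norm (\<iota> (G n s - g s)) \<le> norm (G n s - g s) * K" by (rule K(2))
      also have "\<dots> \<le> \<theta> n * K"
        using G[OF s, of n] K(1) by (intro mult_right_mono) (simp_all add: norm_minus_commute)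
      finally show ?thesis by (simp add: \<iota>.diff mult.commute)
    qed
  qed
  then have *: "eventually (\<lambda>n. norm (\<iota> (Y n) - \<iota> y) \<le> (K * \<theta> n) * N) sequentially"
    by (rule always_eventually[OF allI])
  have "(\<lambda>n. (K * \<theta> n) * N) \<longlonglongrightarrow> (K * 0) * N" by (intro tendsto_intros \<theta>0)
  then have "(\<lambda>n. (K * \<theta> n) * N) \<longlonglongrightarrow> 0" by simp
  with * have "(\<lambda>n. \<iota> (Y n) - \<iota> y) \<longlonglongrightarrow> 0" by (rule Lim_null_comparison)
  then have "(\<lambda>n. \<iota> (Y n)) \<longlonglongrightarrow> \<iota> y" by (rule LIM_zero_cancel)
  moreover have "(\<lambda>n. \<iota> (Y n)) \<longlonglongrightarrow> \<iota> Z" by (rule \<iota>.tendsto[OF Z])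
  ultimately have "\<iota> Z = \<iota> y" by (rule LIMSEQ_unique[rotated])
  then have "Z = y" by (rule injD[OF \<iota>(2)])
  then have "(\<lambda>n. infdist (Y n) V) \<longlonglongrightarrow> infdist y V"
    using Z by (auto intro: tendsto_infdist)
  then show ?thesis unfolding N_def[symmetric]
    by (rule LIMSEQ_le_const2) (use YV in auto)
qed

subsection \<open>The semigroup on the extrapolation space\<close>

text \<open>Read off from the complex Gamma integral: the norm of its integrand at a real exponent
  is the real integrand, and the endpoint \<open>0\<close> is negligible.\<close>

lemma integrable_powr_exp:
  assumes "0 < \<gamma>" "0 < (a::real)"
  shows "(\<lambda>t. t powr (\<gamma> - 1) * exp (- a * t)) integrable_on {0..}"
proof -
  have "(\<lambda>t. complex_of_real t powr (complex_of_real \<gamma> - 1) / of_real (exp (a * t))) absolutely_integrable_on {0<..}"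
    using absolutely_integrable_Gamma_integral[of "complex_of_real \<gamma>" a] assms by simp
  then have "(\<lambda>t. norm (complex_of_real t powr (complex_of_real \<gamma> - 1) / of_real (exp (a * t)))) integrable_on {0<..}"
    by (simp add: absolutely_integrable_on_def)
  then have "(\<lambda>t. t powr (\<gamma> - 1) * exp (- a * t)) integrable_on {0<..}"
    by (rule integrable_eq) (simp add: norm_mult norm_inverse norm_powr_real_powr exp_minus divide_inverse)
  then show ?thesis
    by (rule integrable_spike_set) (auto intro: negligible_subset[of "{0}"])
qed

text \<open>Since \<open>w < lam\<close>, the growth bound leaves the decaying factor
  \<open>exp (- (lam - w) * t)\<close>, while a positive \<gamma> makes
  \<open>t powr (\<gamma> - 1)\<close> integrable at zero. Continuity of \<iota> rests on
  this.\<close>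

lemma neg_frac_power_bounded:
  fixes S :: "real \<Rightarrow> 'a::banach \<Rightarrow> 'a"
  assumes "0 \<le> \<gamma>" and gb: "growth_bound_below S lam"
  shows "\<exists>K. \<forall>x. norm (neg_frac_power S lam \<gamma> x) \<le> K * norm x"
proof (cases "\<gamma> = 0")
  case True
  then show ?thesis by (intro exI[of _ 1]) (simp add: neg_frac_power_def)
next
  case False
  with assms have \<gamma>: "0 < \<gamma>" by simp
  obtain M w where w: "w < lam" and M: "\<And>t x. 0 \<le> t \<Longrightarrow> norm (S t x) \<le> M * exp (w * t) * norm x"
    using gb unfolding growth_bound_below_def by blast
  define g where "g t = t powr (\<gamma> - 1) * exp (- (lam - w) * t)" for t
  have g: "g integrable_on {0..}"
    unfolding g_def[abs_def] by (rule integrable_powr_exp) (use \<gamma> w in auto)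
  have "norm (neg_frac_power S lam \<gamma> x) \<le> (\<bar>1 / Gamma \<gamma>\<bar> * (\<bar>M\<bar> * integral {0..} g)) * norm x" for x
  proof -
    let ?f = "\<lambda>t. (t powr (\<gamma> - 1) * exp (- lam * t)) *\<^sub>R S t x"
    have g0: "0 \<le> integral {0..} g"
      by (intro integral_nonneg g) (simp add: g_def)
    have "norm (integral {0..} ?f) \<le> (\<bar>M\<bar> * integral {0..} g) * norm x"
    \<comment> \<open>If \<open>?f\<close> is not integrable, its integral is \<open>0\<close> by
      convention and the bound is trivial.\<close>
    proof (cases "?f integrable_on {0..}")
      case True
      have "norm (integral {0..} ?f) \<le> integral {0..} (\<lambda>t. (\<bar>M\<bar> * norm x) *\<^sub>R g t)"
      proof (rule integral_norm_bound_integral[OF True integrable_cmul[OF g]])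
        fix t :: real assume "t \<in> {0..}"
        then have t: "0 \<le> t" by simp
        have "norm (S t x) \<le> \<bar>M\<bar> * exp (w * t) * norm x"
          by (rule order.trans[OF M[OF t]]) (intro mult_right_mono, auto)
        then have "norm (?f t) \<le> (t powr (\<gamma> - 1) * exp (- lam * t)) * (\<bar>M\<bar> * exp (w * t) * norm x)"
          by (simp add: mult_left_mono)
        also have "\<dots> = (\<bar>M\<bar> * norm x) *\<^sub>R g t"
          by (simp add: g_def algebra_simps flip: exp_add)
        finally show "norm (?f t) \<le> (\<bar>M\<bar> * norm x) *\<^sub>R g t" .
      qed
      then show ?thesis by (simp add: mult.commute mult.left_commute)
    qed (use g0 in \<open>simp add: not_integrable_integral\<close>)
    then show ?thesis
      using mult_left_mono[of _ _ "\<bar>1 / Gamma \<gamma>\<bar>"] False by (simp add: neg_frac_power_def mult.assoc)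
  qed
  then show ?thesis by blast
qed

lemma extrapolation_embedding_bounded_linear:
  fixes S :: "real \<Rightarrow> 'h::banach \<Rightarrow> 'h" and \<iota> :: "'h \<Rightarrow> 'e::banach"
  assumes "0 \<le> \<gamma>" "growth_bound_below S lam" "extrapolation_space S lam \<gamma> \<iota>"
  shows "bounded_linear \<iota>"
proof -
  obtain K where "\<And>x. norm (neg_frac_power S lam \<gamma> x) \<le> K * norm x"
    using neg_frac_power_bounded[OF assms(1,2)] by blast
  then show ?thesis
    using assms(3) unfolding extrapolation_space_def
    by (intro bounded_linear_intro[of \<iota> K]) (auto simp: linear_add linear_scale mult.commute)
qed

text \<open>Strong continuity is given only from the right at zero. Taking the smaller of two times
  as base point \<open>s\<close>, the difference is \<open>S s (S h x - x)\<close>; a uniform bound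
  on \<open>S s\<close> near \<open>t0\<close> then covers both sides.\<close>

lemma C0_semigroup_continuous_on:
  fixes S :: "real \<Rightarrow> 'h::banach \<Rightarrow> 'h"
  assumes S: "C0_semigroup S" and gb: "growth_bound_below S lam"
  shows "continuous_on {0..} (\<lambda>t. S t x)"
  unfolding continuous_on_iff
proof (intro ballI allI impI)
  fix t0 e :: real assume t0: "t0 \<in> {0..}" and e: "0 < e"
  obtain M w where M: "\<And>t x. 0 \<le> t \<Longrightarrow> norm (S t x) \<le> M * exp (w * t) * norm x"
    using gb unfolding growth_bound_below_def by blast
  define C where "C = \<bar>M\<bar> * exp (\<bar>w\<bar> * (t0 + 1)) + 1"
  have C: "0 < C" by (simp add: C_def add_nonneg_pos)
  have bound: "norm (S t y) \<le> C * norm y" if "0 \<le> t" "t \<le> t0 + 1" for t y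
  proof -
    have "w * t \<le> \<bar>w\<bar> * (t0 + 1)" using that by (intro mult_mono) auto
    then have "M * exp (w * t) * norm y \<le> \<bar>M\<bar> * exp (\<bar>w\<bar> * (t0 + 1)) * norm y"
      by (intro mult_right_mono mult_mono) auto
    also have "\<dots> \<le> C * norm y" by (intro mult_right_mono) (auto simp: C_def)
    finally show ?thesis using M[OF that(1), of y] by linarith
  qed
  have "((\<lambda>t. S t x) \<longlongrightarrow> x) (at_right 0)" and S0: "S 0 x = x"
    and sg: "\<And>s t. 0 \<le> s \<Longrightarrow> 0 \<le> t \<Longrightarrow> S (s + t) x = S s (S t x)"
    and lin: "\<And>t. 0 \<le> t \<Longrightarrow> bounded_linear (S t)"
    using S by (auto simp: C0_semigroup_def)
  then have "eventually (\<lambda>h. dist (S h x) x < e / C) (at_right 0)"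
    using e C by (intro tendstoD) auto
  then obtain b where b: "0 < b" "\<And>h. 0 < h \<Longrightarrow> h < b \<Longrightarrow> dist (S h x) x < e / C"
    by (auto simp: eventually_at_right_field)
  have small: "norm (S h x - x) < e / C" if "0 \<le> h" "h < b" for h
    using that b S0 e C by (cases "h = 0") (auto simp: dist_norm)
  have step: "dist (S (s + h) x) (S s x) < e" if "0 \<le> s" "s \<le> t0 + 1" "0 \<le> h" "h < b" for s h
  proof -
    interpret bounded_linear "S s" by (rule lin[OF that(1)])
    have "dist (S (s + h) x) (S s x) = norm (S s (S h x - x))"
      using that sg by (simp add: dist_norm diff)
    also have "\<dots> \<le> C * norm (S h x - x)" by (rule bound[OF that(1,2)])
    also have "\<dots> < C * (e / C)" using small[OF that(3,4)] C by (intro mult_strict_left_mono)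
    finally show ?thesis using C by simp
  qed
  show "\<exists>d>0. \<forall>t\<in>{0..}. dist t t0 < d \<longrightarrow> dist (S t x) (S t0 x) < e"
  proof (intro exI[of _ "min b 1"] conjI ballI impI)
    show "0 < min b 1" using b by simp
    fix t assume t: "t \<in> {0..}" "dist t t0 < min b 1"
    show "dist (S t x) (S t0 x) < e"
    proof (cases "t0 \<le> t")
      case True
      then show ?thesis using step[of t0 "t - t0"] t t0 by (auto simp: dist_real_def)
    next
      case False
      then show ?thesis using step[of t "t0 - t"] t t0 by (auto simp: dist_real_def dist_commute)
    qed
  qed
qed

text \<open>Both sides are continuous in \<open>y\<close> and agree on the dense range of
  \<iota>.\<close>

lemma extended_semigroup_add:
  fixes \<iota> :: "'h::banach \<Rightarrow> 'e::banach"
  assumes S: "C0_semigroup S" and ext: "extends_semigroup \<iota> S SE" and dense: "closure (range \<iota>) = UNIV"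
    and st: "0 \<le> s" "0 \<le> t"
  shows "SE (s + t) y = SE s (SE t y)"
proof -
  have lin: "bounded_linear (SE r)" and eq: "SE r (\<iota> x) = \<iota> (S r x)" if "0 \<le> r" for r x
    using ext that by (auto simp: extends_semigroup_def)
  have cont: "continuous_on UNIV (SE r)" if "0 \<le> r" for r
    using lin[OF that] by (rule linear_continuous_on)
  have "closed {y. SE (s + t) y = SE s (SE t y)}"
    using st by (intro closed_Collect_eq cont continuous_on_compose2[OF cont cont]) auto
  moreover have "range \<iota> \<subseteq> {y. SE (s + t) y = SE s (SE t y)}"
    using st S by (auto simp: eq C0_semigroup_def)
  ultimately have "closure (range \<iota>) \<subseteq> {y. SE (s + t) y = SE s (SE t y)}"
    by (rule closure_minimal[rotated])
  then show ?thesis using dense by auto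
qed

lemma L2_fun_absolutely_integrable:
  assumes "L2_fun T v"
  shows "v absolutely_integrable_on {0..T}"
proof -
  have v: "v \<in> borel_measurable (lebesgue_on {0..T})" "integrable (lebesgue_on {0..T}) (\<lambda>s. (v s)\<^sup>2)"
    using assms by (auto simp: L2_fun_def)
  interpret finite_measure "lebesgue_on {0..T}"
    by (rule finite_measure_lebesgue_on) simp
  have "integrable (lebesgue_on {0..T}) v"
  proof (rule Bochner_Integration.integrable_bound[where f="\<lambda>s. 1 + (v s)\<^sup>2"])
    have "norm (v s) \<le> norm (1 + (v s)\<^sup>2)" for s
      using sum_squares_bound[of "\<bar>v s\<bar>" 1] by (simp add: power2_eq_square)
    then show "AE s in lebesgue_on {0..T}. norm (v s) \<le> norm (1 + (v s)\<^sup>2)" by simp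
  qed (use v in auto)
  then show ?thesis by (simp add: set_integrable_def integrable_restrict_space)
qed

subsection \<open>States reached from the control orbit\<close>

text \<open>\<open>regular\<close> asks for values in the range of \<iota> only at arbitrarily small
  times, which is what an almost everywhere identity can deliver. The semigroup law carries the
  orbit to all later positive times inside that range.\<close>

locale control_orbit =
  fixes S :: "real \<Rightarrow> 'h::banach \<Rightarrow> 'h" and lam \<gamma> T :: real
    and \<iota> :: "'h \<Rightarrow> 'e::banach" and SE :: "real \<Rightarrow> 'e \<Rightarrow> 'e" and B :: "real \<Rightarrow> 'e"
  assumes S: "C0_semigroup S" and \<gamma>: "0 \<le> \<gamma>" and growth: "growth_bound_below S lam"
    and space: "extrapolation_space S lam \<gamma> \<iota>" and ext: "extends_semigroup \<iota> S SE"
    and B: "bounded_linear B" and T: "0 < T"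
    and regular: "\<And>r. 0 < r \<Longrightarrow> \<exists>q. 0 < q \<and> q < r \<and> SE q (B 1) \<in> range \<iota>"
begin

text \<open>As \<open>B\<close> has a one-dimensional domain, this single curve describes all
  integrands. It is meaningful for \<open>0 < r\<close>; at \<open>r = 0\<close> the vector
  \<open>B 1\<close> need not lie in the range of \<iota>.\<close>

definition orbit :: "real \<Rightarrow> 'h" where
  "orbit r = inv \<iota> (SE r (B 1))"

lemma inj_\<iota>: "inj \<iota>" and dense_\<iota>: "closure (range \<iota>) = UNIV"
  using space by (auto simp: extrapolation_space_def)

lemma bounded_linear_\<iota>: "bounded_linear \<iota>"
  by (rule extrapolation_embedding_bounded_linear[OF \<gamma> growth space])

lemma SE_\<iota>: "0 \<le> t \<Longrightarrow> SE t (\<iota> x) = \<iota> (S t x)"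
  using ext by (simp add: extends_semigroup_def)

lemma SE_add: "0 \<le> s \<Longrightarrow> 0 \<le> t \<Longrightarrow> SE (s + t) y = SE s (SE t y)"
  by (rule extended_semigroup_add[OF S ext dense_\<iota>])

lemma SE_B: "0 \<le> r \<Longrightarrow> SE r (B z) = z *\<^sub>R SE r (B 1)"
  using B ext bounded_linear.linear[of "SE r"] bounded_linear.linear[OF B]
    linear_scale[of B z 1] linear_scale[of "SE r" z "B 1"]
  by (simp add: extends_semigroup_def)

lemma \<iota>_orbit:
  assumes "0 < r" shows "\<iota> (orbit r) = SE r (B 1)"
proof -
  obtain q x where q: "0 < q" "q < r" "SE q (B 1) = \<iota> x"
    using regular[OF assms] by auto
  then have "SE r (B 1) = \<iota> (S (r - q) x)"
    using SE_add[of "r - q" q "B 1"] SE_\<iota>[of "r - q" x] by simp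
  then show ?thesis unfolding orbit_def by (simp add: inj_\<iota>)
qed

lemma orbit_add:
  assumes "0 \<le> t" "0 < r" shows "orbit (t + r) = S t (orbit r)"
proof -
  have "\<iota> (orbit (t + r)) = \<iota> (S t (orbit r))"
    using assms SE_add[of t r "B 1"] \<iota>_orbit[of r] \<iota>_orbit[of "t + r"] SE_\<iota>[of t "orbit r"] by simp
  then show ?thesis using inj_\<iota> by (rule injD[rotated])
qed

text \<open>Continuity holds in the norm of \<open>'h\<close>, although \<iota> need not have a
  continuous inverse: from time \<open>r / 2\<close> on, the curve is an orbit of \<open>S\<close>
  starting in \<open>'h\<close>.\<close>

lemma continuous_on_orbit: "continuous_on {0<..} orbit"
proof (rule continuous_at_imp_continuous_on, rule ballI)
  fix r :: real assume "r \<in> {0<..}"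
  then have r: "0 < r" by simp
  have "continuous_on {r/2..} (\<lambda>q. S (q - r/2) (orbit (r/2)))"
    by (intro continuous_on_compose2[OF C0_semigroup_continuous_on[OF S growth]] continuous_intros) auto
  moreover have "S (q - r/2) (orbit (r/2)) = orbit q" if "q \<in> {r/2..}" for q
    using orbit_add[of "q - r/2" "r/2"] that r by simp
  ultimately have "continuous_on {r/2..} orbit"
    by (rule continuous_on_eq)
  then have "continuous_on {r/2<..} orbit" by (rule continuous_on_subset) auto
  then show "isCont orbit r"
    using r by (simp add: continuous_on_eq_continuous_at)
qed

text \<open>The integrand \<open>v s *\<^sub>R orbit (T - s)\<close> need not be integrable in \<open>'h\<close> near \<open>s = T\<close>. Letting
  the controlled system run up to the time \<open>T + \<tau>\<close> removes this singularity.\<close>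

lemma controlled_state_in_closure:
  assumes "null_controllable S \<iota> SE B T"
  shows "- S T x \<in> closure (span (orbit ` {0<..<T}))"
proof -
  define V where "V = span (orbit ` {0<..<T})"
  have V: "subspace V" by (simp add: V_def)
  have oV: "orbit r \<in> V" if "0 < r" "r < T" for r
    unfolding V_def by (rule span_base) (use that in auto)
  interpret \<iota>: bounded_linear \<iota> by (rule bounded_linear_\<iota>)
  obtain v w where v: "L2_fun T v" and w: "mild_control_solution S \<iota> SE B T x v w" "w T = 0"
    using assms unfolding null_controllable_def by blast
  have va: "v absolutely_integrable_on {0..T}" by (rule L2_fun_absolutely_integrable[OF v])
  define N where "N = integral {0..T} (\<lambda>s. \<bar>v s\<bar>)"
  have N: "0 \<le> N" unfolding N_def using va
    by (intro integral_nonneg) (auto simp: absolutely_integrable_on_def)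
  have "((\<lambda>s. SE (T - s) (B (v s))) has_integral (w T - \<iota> (S T x))) {0..T}"
    using w(1) T unfolding mild_control_solution_def by auto
  then have ctl: "((\<lambda>s. SE (T - s) (B (v s))) has_integral \<iota> (- S T x)) {0..T}"
    by (simp add: w(2) \<iota>.neg)
  have later: "((\<lambda>s. v s *\<^sub>R \<iota> (orbit (\<tau> + (T - s)))) has_integral \<iota> (- S (\<tau> + T) x)) {0..T}" if \<tau>: "0 < \<tau>" for \<tau>
  proof -
    have lin: "bounded_linear (SE \<tau>)" using ext \<tau> by (simp add: extends_semigroup_def)
    have 1: "((\<lambda>s. SE \<tau> (SE (T - s) (B (v s)))) has_integral SE \<tau> (\<iota> (- S T x))) {0..T}"
      using has_integral_linear[OF ctl lin] by (simp add: o_def)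
    have 2: "SE \<tau> (SE (T - s) (B (v s))) = v s *\<^sub>R \<iota> (orbit (\<tau> + (T - s)))" if "s \<in> {0..T}" for s
      using that \<tau> SE_add[of \<tau> "T - s" "B (v s)"] SE_B[of "\<tau> + (T - s)" "v s"] \<iota>_orbit[of "\<tau> + (T - s)"]
      by simp
    have 3: "SE \<tau> (\<iota> (- S T x)) = \<iota> (- S (\<tau> + T) x)"
      using \<tau> T S SE_\<iota>[of \<tau> "S T x"] bounded_linear.linear[OF lin]
      by (simp add: \<iota>.neg linear_neg C0_semigroup_def)
    show ?thesis using has_integral_eq[OF 2 1] by (simp only: 3)
  qed
  have le: "infdist (- S T x) V \<le> d * (N + 1)" if d: "0 < d" for d
  proof -
    have "isCont orbit T"
      using continuous_on_orbit T by (simp add: continuous_on_eq_continuous_at)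
    then obtain b where b: "0 < b" "\<And>r. dist r T < b \<Longrightarrow> dist (orbit r) (orbit T) < d / 2"
      unfolding continuous_at_eps_delta using d by (metis half_gt_zero)
    \<comment> \<open>The times \<open>\<tau> + (T - s)\<close> may reach or exceed
      \<open>T\<close>, where they give no generators of \<open>V\<close>; \<open>r1\<close> is a
      generator time just before \<open>T\<close> at which the orbit is close to those
      values.\<close>
    define r1 where "r1 = T - min (b/2) (T/2)"
    have r1: "0 < r1" "r1 < T" "dist r1 T < b" using b(1) T by (auto simp: r1_def dist_real_def)
    have "continuous_on {0..} (\<lambda>t. S t (S T x))" by (rule C0_semigroup_continuous_on[OF S growth])
    then obtain b2 where b2: "0 < b2" "\<And>t. 0 \<le> t \<Longrightarrow> t < b2 \<Longrightarrow> dist (S t (S T x)) (S 0 (S T x)) < d"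
      unfolding continuous_on_iff using d by (force simp: dist_real_def)
    \<comment> \<open>The bound by \<open>b\<close> keeps the times past \<open>T\<close> near
      \<open>T\<close>, and \<open>b2\<close> makes the extra evolution over \<tau> move
      \<open>S T x\<close> by less than \<open>d\<close>.\<close>
    define \<tau> where "\<tau> = min (b/2) (b2/2)"
    have \<tau>: "0 < \<tau>" "\<tau> < b" "\<tau> < b2" using b(1) b2(1) by (auto simp: \<tau>_def)
    have "infdist (- S (\<tau> + T) x) V \<le> d * integral {0..T} (\<lambda>s. \<bar>v s\<bar>)"
    proof (rule weighted_integral_infdist[OF T va _ bounded_linear_\<iota> inj_\<iota> later[OF \<tau>(1)] V])
      show "continuous_on {0..T} (\<lambda>s. orbit (\<tau> + (T - s)))"
        by (rule continuous_on_compose2[OF continuous_on_orbit]) (use \<tau> in \<open>auto intro!: continuous_intros\<close>)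
      fix s assume s: "s \<in> {0..T}"
      show "infdist (orbit (\<tau> + (T - s))) V \<le> d"
      proof (cases "\<tau> + (T - s) < T")
        case True
        then have "orbit (\<tau> + (T - s)) \<in> V" using s \<tau> by (intro oV) auto
        then show ?thesis using d by simp
      next
        case False
        then have "dist (\<tau> + (T - s)) T < b" using s \<tau> by (auto simp: dist_real_def)
        then have "dist (orbit (\<tau> + (T - s))) (orbit r1) \<le> d"
          using b(2)[of r1] b(2)[of "\<tau> + (T - s)"] r1(3) dist_triangle2[of "orbit (\<tau> + (T - s))" "orbit r1" "orbit T"]
          by linarith
        then show ?thesis using infdist_le2[OF oV[OF r1(1,2)]] by blast
      qed
    qed
    moreover have "infdist (- S T x) V \<le> infdist (- S (\<tau> + T) x) V + dist (- S T x) (- S (\<tau> + T) x)"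
      by (rule infdist_triangle)
    moreover have "dist (- S T x) (- S (\<tau> + T) x) \<le> d"
      using b2(2)[of \<tau>] \<tau> S T by (simp add: dist_minus dist_commute C0_semigroup_def less_imp_le)
    ultimately show ?thesis by (simp add: N_def distrib_left)
  qed
  have "infdist (- S T x) V \<le> 0 + e" if "0 < e" for e
    using le[of "e / (N + 1)"] that N by (simp add: add_nonneg_pos)
  then have "infdist (- S T x) V \<le> 0" by (rule field_le_epsilon)
  then have "infdist (- S T x) V = 0" using infdist_nonneg[of "- S T x" V] by simp
  then show ?thesis
    using V subspace_0 unfolding V_def by (subst in_closure_iff_infdist_zero) auto
qed

end

subsection \<open>Jumps generate the control orbit\<close>

lemma sums_of_scaled_contain_span:
  fixes f :: "'i \<Rightarrow> 'b::real_vector"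
  assumes E: "\<And>i z. i \<in> R \<Longrightarrow> \<epsilon> < \<bar>z\<bar> \<Longrightarrow> \<bar>z\<bar> < r0 \<Longrightarrow> z *\<^sub>R f i \<in> E"
    and \<epsilon>: "0 < \<epsilon>" "\<epsilon> < r0"
  shows "span (f ` R) \<subseteq> {sum_list l | l. set l \<subseteq> E}"
proof
  let ?W = "{sum_list l | l. set l \<subseteq> E}"
  have W0: "0 \<in> ?W" by (auto intro!: exI[of _ "[]"])
  have WE: "e \<in> ?W" if "e \<in> E" for e
    using that by (auto intro!: exI[of _ "[e]"])
  have Wadd: "a + b \<in> ?W" if ab: "a \<in> ?W" "b \<in> ?W" for a b
  proof -
    obtain l l' where "a = sum_list l" "set l \<subseteq> E" "b = sum_list l'" "set l' \<subseteq> E"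
      using ab by auto
    then show ?thesis by (auto intro!: exI[of _ "l @ l'"])
  qed
  have Wmul: "real n *\<^sub>R a \<in> ?W" if a: "a \<in> ?W" for a n
  proof (induction n)
    case (Suc n)
    then show ?case using Wadd[OF a Suc] by (simp only: of_nat_Suc scaleR_add_left scaleR_one add.commute)
  qed (use W0 in auto)
  have Wf: "c *\<^sub>R f i \<in> ?W" if i: "i \<in> R" for c i
  proof -
    define q where "q = (r0 - \<epsilon>) / 2"
    have q: "0 < q" using \<epsilon> by (simp add: q_def)
    obtain n :: nat where n: "\<bar>c\<bar> / q < n" using reals_Archimedean2 by blast
    then have n0: "0 < n" using q by (cases n) (auto simp: divide_less_0_iff)
    \<comment> \<open>Then \<open>n\<close> copies of a pair of jumps with sizes
      \<open>m + \<beta>\<close> and \<open>- (m - \<beta>)\<close> have total coefficient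
      \<open>2 * n * \<beta> = c\<close>; large \<open>n\<close> keeps both sizes admissible,
      \<open>m\<close> being the midpoint of the allowed range.\<close>
    define \<beta> where "\<beta> = c / (2 * n)"
    have \<beta>: "\<bar>\<beta>\<bar> < q" using n n0 q by (auto simp: \<beta>_def field_simps abs_mult)
    define m where "m = (\<epsilon> + r0) / 2"
    have "(m + \<beta>) *\<^sub>R f i \<in> E" "(- (m - \<beta>)) *\<^sub>R f i \<in> E"
      using \<beta> \<epsilon> by (intro E i; simp add: m_def q_def abs_if field_simps split: if_splits; linarith)+
    then have "real n *\<^sub>R ((m + \<beta>) *\<^sub>R f i + (- (m - \<beta>)) *\<^sub>R f i) \<in> ?W"
      by (intro Wmul Wadd WE)
    also have "real n *\<^sub>R ((m + \<beta>) *\<^sub>R f i + (- (m - \<beta>)) *\<^sub>R f i) = c *\<^sub>R f i"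
      using n0 by (simp add: \<beta>_def flip: scaleR_add_left)
    finally show ?thesis .
  qed
  fix x assume "x \<in> span (f ` R)"
  then show "x \<in> ?W"
  proof (induction rule: span_induct_alt)
    case base
    show ?case by (rule W0)
  next
    case (step c x y)
    then obtain i where "i \<in> R" "x = f i" by blast
    then show ?case using Wadd[OF Wf step(2)] by simp
  qed
qed

section \<open>Positive measure of boxes of small jumps and essential values of the
  integrand\<close>

lemma density_interval_pos:
  fixes k :: "real \<Rightarrow> real"
  assumes k: "k \<in> borel_measurable borel" and pos: "\<And>r. r \<in> {a<..<b} \<Longrightarrow> 0 < k r" and ab: "a < b"
  shows "0 < emeasure (density lborel (\<lambda>r. ennreal (k r))) {a<..<b}"
proof (rule ccontr)
  assume "\<not> ?thesis"
  moreover have km: "(\<lambda>r. ennreal (k r)) \<in> borel_measurable lborel"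
    using k by (intro measurable_compose[OF _ measurable_ennreal]) simp
  ultimately have "(\<integral>\<^sup>+r. ennreal (k r) * indicator {a<..<b} r \<partial>lborel) = 0"
    using emeasure_density[OF km, of "{a<..<b}"] by simp
  then have "AE r in lborel. ennreal (k r) * indicator {a<..<b} r = 0"
    using km by (subst (asm) nn_integral_0_iff_AE) auto
  then have "AE r in lborel. r \<notin> {a<..<b}"
  proof eventually_elim
    case (elim r)
    show ?case
    proof
      assume "r \<in> {a<..<b}"
      then show False using elim pos[of r] by (simp add: ennreal_eq_0_iff)
    qed
  qed
  then have "emeasure lborel {a<..<b} = 0"
    by (subst (asm) AE_iff_measurable[of "{a<..<b}"]) auto
  then show False using ab by simp
qed

lemma AE_witness_in:
  assumes "AE p in M. R p" "0 < emeasure M A"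
  shows "\<exists>p\<in>A. R p"
proof (rule ccontr)
  assume *: "\<not> ?thesis"
  have "AE p in M. p \<notin> A" using assms(1) by eventually_elim (use * in auto)
  \<comment> \<open>A set outside the sigma-algebra has \<open>emeasure\<close> zero, so positivity
    entails measurability.\<close>
  moreover have "A \<in> sets M" using assms(2) emeasure_notin_sets by force
  ultimately have "emeasure M A = 0"
    using sets.sets_into_space by (subst (asm) AE_iff_measurable[of A]) auto
  with assms(2) show False by simp
qed

locale small_jumps =
  fixes \<nu> :: "real measure" and k :: "real \<Rightarrow> real" and r0 :: real
  assumes k: "k \<in> borel_measurable borel" and \<nu>: "\<nu> = density lborel (\<lambda>r. ennreal (k r))"
    and r0: "0 < r0" and pos: "\<And>r. 0 < \<bar>r\<bar> \<Longrightarrow> \<bar>r\<bar> \<le> r0 \<Longrightarrow> 0 < k r"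
begin

lemma sets_\<nu>: "sets \<nu> = sets borel"
  by (simp add: \<nu>)

lemma box_pos:
  assumes "a < b" "\<And>z. z \<in> {a<..<b} \<Longrightarrow> 0 < \<bar>z\<bar> \<and> \<bar>z\<bar> \<le> r0" "0 \<le> c" "c < d"
  shows "0 < emeasure (compensator \<nu>) ({a<..<b} \<times> {c<..<d})"
proof -
  have "0 < emeasure \<nu> {a<..<b}"
    unfolding \<nu> using assms pos by (intro density_interval_pos k) auto
  moreover have "0 < emeasure lborel {c<..<d}" using assms by simp
  ultimately show ?thesis
    using assms sets_\<nu> by (subst compensator_Times(2)) (auto simp: ennreal_zero_less_mult_iff)
qed

end

locale jump_orbit = small_jumps \<nu> k r0 + control_orbit S lam \<gamma> T \<iota> SE B
  for \<nu> k r0 and S :: "real \<Rightarrow> 'h::banach \<Rightarrow> 'h" and lam \<gamma> T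
    and \<iota> :: "'h \<Rightarrow> 'e::banach" and SE B +
  fixes \<Phi> :: "real \<times> real \<Rightarrow> 'h"
  assumes \<Phi>: "AE (z, s) in compensator \<nu>. 0 < s \<and> s \<le> T \<longrightarrow> \<iota> (\<Phi> (z, s)) = SE (T - s) (B z)"
begin

lemma AE_integrand:
  "AE p in compensator \<nu>. 0 < snd p \<and> snd p \<le> T \<longrightarrow>
     0 < snd p \<and> snd p < T \<and> \<Phi> p = fst p *\<^sub>R orbit (T - snd p)"
proof -
  \<comment> \<open>The time \<open>T\<close> is removed because the integrand there would involve
    \<open>B 1\<close> itself. The slice is null even for infinite \<nu>, as infinity times zero is
    zero.\<close>
  have "UNIV \<times> {T} \<in> null_sets (compensator \<nu>)"
    using compensator_Times[OF sets_\<nu>, of UNIV "{T}"] T by (auto intro!: null_setsI)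
  then have "AE p in compensator \<nu>. p \<notin> UNIV \<times> {T}" by (rule AE_not_in)
  with \<Phi> show ?thesis
  proof eventually_elim
    case (elim p)
    obtain z s where p: "p = (z, s)" by (cases p)
    show ?case
    proof
      assume "0 < snd p \<and> snd p \<le> T"
      then have s: "0 < s" "s < T" using elim(2) by (auto simp: p)
      then have "\<iota> (\<Phi> p) = z *\<^sub>R SE (T - s) (B 1)" using elim(1) SE_B[of "T - s" z] by (simp add: p)
      also have "\<dots> = \<iota> (z *\<^sub>R orbit (T - s))"
        using s \<iota>_orbit[of "T - s"] bounded_linear.linear[OF bounded_linear_\<iota>] by (simp add: linear_scale)
      finally have "\<Phi> p = z *\<^sub>R orbit (T - s)" by (rule injD[OF inj_\<iota>])
      then show "0 < snd p \<and> snd p < T \<and> \<Phi> p = fst p *\<^sub>R orbit (T - snd p)" using s by (simp add: p)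
    qed
  qed
qed

text \<open>Almost everywhere \<Phi> equals a function continuous at \<open>(z0, T - q)\<close>, and
  small boxes around this point have positive compensator measure. Were the values near
  \<open>z0 *\<^sub>R orbit q\<close> taken only on a null set, such a box would be null as
  well.\<close>

lemma essential_value_orbit:
  assumes \<epsilon>: "0 < \<epsilon>" and z0: "\<epsilon> < \<bar>z0\<bar>" "\<bar>z0\<bar> < r0" and q: "0 < q" "q < T"
    and m: "\<Phi> \<in> borel_measurable (restrict_space (compensator \<nu>) (jumps_above \<epsilon> T))"
  shows "z0 *\<^sub>R orbit q \<in> essential_values (compensator \<nu>) (jumps_above \<epsilon> T) \<Phi>"
  unfolding essential_values_def
proof (intro CollectI allI impI)
  fix \<rho> :: real assume \<rho>: "0 < \<rho>"
  let ?v = "z0 *\<^sub>R orbit q"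
  let ?F = "\<lambda>p. fst p *\<^sub>R orbit (T - snd p)"
  have "isCont orbit q"
    using continuous_on_orbit q by (simp add: continuous_on_eq_continuous_at)
  moreover have "isCont (\<lambda>p. T - snd p) (z0, T - q)"
    by (intro continuous_diff continuous_const continuous_snd continuous_ident)
  ultimately have "isCont (\<lambda>p. orbit (T - snd p)) (z0, T - q)"
    using isCont_o2[of "(z0, T - q)" "\<lambda>p. T - snd p" orbit] by simp
  then have "isCont ?F (z0, T - q)"
    by (intro continuous_scaleR continuous_fst continuous_ident)
  then obtain d where d: "0 < d" "\<And>p. dist p (z0, T - q) < d \<Longrightarrow> dist (?F p) (?F (z0, T - q)) < \<rho>"
    unfolding continuous_at_eps_delta using \<rho> by metis
  \<comment> \<open>The terms keep the box in the continuity neighbourhood, its times in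
    \<open>(0, T)\<close>, and its jump sizes in absolute value between \<epsilon> and
    \<open>r0\<close>.\<close>
  define b where "b = min (d / 2) (min (min q (T - q)) (min (\<bar>z0\<bar> - \<epsilon>) (r0 - \<bar>z0\<bar>)))"
  have "0 < b" using d(1) q z0 by (simp add: b_def)
  moreover have "b \<le> d / 2" "b \<le> q" "b \<le> T - q" "b \<le> \<bar>z0\<bar> - \<epsilon>" "b \<le> r0 - \<bar>z0\<bar>"
    unfolding b_def by linarith+
  ultimately have b: "0 < b" "b \<le> d / 2" "b \<le> q" "b \<le> T - q" "b \<le> \<bar>z0\<bar> - \<epsilon>" "b \<le> r0 - \<bar>z0\<bar>"
    by blast+
  let ?box = "{z0 - b<..<z0 + b} \<times> {T - q - b<..<T - q + b}"
  have zb: "\<epsilon> < \<bar>z\<bar> \<and> \<bar>z\<bar> \<le> r0" if "z \<in> {z0 - b<..<z0 + b}" for z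
    using that b z0 by auto
  have box: "0 < emeasure (compensator \<nu>) ?box"
    using b \<epsilon> zb by (intro box_pos) (auto dest!: zb)
  let ?A = "{p \<in> jumps_above \<epsilon> T. norm (\<Phi> p - ?v) < \<rho>}"
  show "0 < emeasure (compensator \<nu>) ?A"
  proof (rule ccontr)
    let ?R = "restrict_space (compensator \<nu>) (jumps_above \<epsilon> T)"
    assume "\<not> ?thesis"
    moreover have "?A \<in> sets (compensator \<nu>)"
    proof -
      have J: "jumps_above \<epsilon> T \<in> sets (compensator \<nu>)" by (rule sets_jumps_above[OF sets_\<nu>])
      have "(\<lambda>p. norm (\<Phi> p - ?v)) \<in> borel_measurable ?R"
        by (rule measurable_compose[OF m]) (intro borel_measurable_continuous_onI continuous_intros)
      then have "{p \<in> space ?R. norm (\<Phi> p - ?v) < \<rho>} \<in> sets ?R" by measurable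
      moreover have "space ?R = jumps_above \<epsilon> T"
        using sets.sets_into_space[OF J] by (auto simp: space_restrict_space)
      ultimately show ?thesis using J by (subst (asm) sets_restrict_space_iff) auto
    qed
    ultimately have "?A \<in> null_sets (compensator \<nu>)" by (auto intro!: null_setsI)
    then have "AE p in compensator \<nu>. p \<notin> ?A" by (rule AE_not_in)
    with AE_integrand have "AE p in compensator \<nu>. p \<notin> ?box"
    proof eventually_elim
      case (elim p)
      show ?case
      proof
        assume p: "p \<in> ?box"
        obtain z s where zs: "p = (z, s)" by (cases p)
        from p have "z0 - b < z" "z < z0 + b" "T - q - b < s" "s < T - q + b" by (auto simp: zs)
        then have s: "0 < s" "s < T" "\<bar>s - (T - q)\<bar> < d / 2" "\<bar>z - z0\<bar> < d / 2"
          using b by linarith+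
        have "p \<in> jumps_above \<epsilon> T" using p s zb[of z] by (auto simp: zs jumps_above_def)
        moreover have "\<Phi> p = ?F p" using elim(1) s by (simp add: zs)
        moreover have "dist p (z0, T - q) < d"
          using s sqrt_sum_squares_le_sum_abs[of "dist z z0" "dist s (T - q)"]
          by (simp add: zs dist_Pair_Pair dist_real_def)
        then have "dist (?F p) (?F (z0, T - q)) < \<rho>" by (rule d(2))
        ultimately show False using elim(2) by (simp add: dist_norm)
      qed
    qed
    from AE_witness_in[OF this box] show False by blast
  qed
qed

lemma jump_sums_dense:
  assumes nc: "null_controllable S \<iota> SE B T" and \<epsilon>: "0 < \<epsilon>" "\<epsilon> < r0"
    and c: "bochner (restrict_space (compensator \<nu>) (jumps_above \<epsilon> T)) \<Phi> c"
  shows "c - S T x \<in> closure {sum_list l | l.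
    set l \<subseteq> essential_values (compensator \<nu>) (jumps_above \<epsilon> T) \<Phi>}"
proof -
  let ?V = "span (orbit ` {0<..<T})"
  have m: "\<Phi> \<in> borel_measurable (restrict_space (compensator \<nu>) (jumps_above \<epsilon> T))"
    using c by (simp add: bochner_def)
  have J: "jumps_above \<epsilon> T \<inter> space (compensator \<nu>) \<in> sets (compensator \<nu>)"
    using sets_jumps_above[OF sets_\<nu>] by auto
  have "AE p in restrict_space (compensator \<nu>) (jumps_above \<epsilon> T). \<Phi> p \<in> ?V"
    unfolding AE_restrict_space_iff[OF J]
    using AE_integrand
  proof eventually_elim
    case (elim p)
    show ?case
    proof
      assume "p \<in> jumps_above \<epsilon> T"
      then have "0 < snd p" "snd p < T" "\<Phi> p = fst p *\<^sub>R orbit (T - snd p)"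
        using elim by (auto simp: jumps_above_def)
      moreover from this have "orbit (T - snd p) \<in> ?V" by (intro span_base imageI) simp
      ultimately show "\<Phi> p \<in> ?V" by (simp add: span_scale)
    qed
  qed
  then have "c \<in> closure ?V" by (rule bochner_in_closure[OF c subspace_span])
  moreover have "- S T x \<in> closure ?V" by (rule controlled_state_in_closure[OF nc])
  ultimately obtain f g where fg: "\<And>n. f n \<in> ?V" "f \<longlonglongrightarrow> c" "\<And>n. g n \<in> ?V" "g \<longlonglongrightarrow> - S T x"
    unfolding closure_sequential by blast
  have "c + - S T x \<in> closure ?V"
    unfolding closure_sequential
    by (intro exI[of _ "\<lambda>n. f n + g n"] conjI allI span_add fg tendsto_add)
  also have "closure ?V \<subseteq> closure {sum_list l | l.
      set l \<subseteq> essential_values (compensator \<nu>) (jumps_above \<epsilon> T) \<Phi>}"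
    by (intro closure_mono sums_of_scaled_contain_span[OF _ \<epsilon>] essential_value_orbit \<epsilon>(1) m) auto
  finally show ?thesis by simp
qed

end

theorem theorem2p5:
  fixes A :: "'h::{real_inner, banach} \<Rightarrow> 'h" and D :: "'h set"
    and S :: "real \<Rightarrow> 'h \<Rightarrow> 'h"
    and \<iota> :: "'h \<Rightarrow> 'e::banach" and SE :: "real \<Rightarrow> 'e \<Rightarrow> 'e"
    and B :: "real \<Rightarrow> 'e"
    and P :: "'w measure" and F :: "real \<Rightarrow> 'w measure"
    and \<nu> :: "real measure" and \<eta> :: "'w \<Rightarrow> (real \<times> real) measure"
    and k :: "real \<Rightarrow> real"
    and u :: "'h \<Rightarrow> real \<Rightarrow> 'w \<Rightarrow> 'h"
    and T \<gamma> lam \<alpha> K0 r0 :: real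
  assumes "generates D A S"
    and "0 \<le> \<gamma>" and "\<gamma> < 1 / 2" and "growth_bound_below S lam"
    and "extrapolation_space S lam \<gamma> \<iota>" and "extends_semigroup \<iota> S SE"
    and "bounded_linear B"
    and "usual_filtration P F" and "levy_measure \<nu>" and "poisson_random_measure P F \<nu> \<eta>"
    and "0 < T" and "null_controllable S \<iota> SE B T"
    and "k \<in> borel_measurable borel" and "\<And>r. 0 \<le> k r"
    and "\<nu> = density lborel (\<lambda>r. ennreal (k r))"
    and "1 < \<alpha>" and "\<alpha> \<le> 2" and "0 < K0" and "0 < r0"
    and "\<And>r. 0 < \<bar>r\<bar> \<Longrightarrow> \<bar>r\<bar> \<le> r0 \<Longrightarrow> k r = K0 * \<bar>r\<bar> powr (- \<alpha> - 1)"
    and "\<And>x. mild_solution P F \<nu> \<eta> S \<iota> SE B x (u x)"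
  shows "\<forall>C>0. \<forall>x\<in>cball 0 C. \<forall>\<delta>>0. \<exists>\<kappa>>0.
           measure P {\<omega> \<in> space P. u x T \<omega> \<in> cball 0 \<delta>} \<ge> \<kappa>"
proof (intro allI impI ballI)
  fix C \<delta> :: real and x assume \<delta>: "0 < \<delta>"
  interpret poisson_measure P F \<nu> \<eta>
    using assms(8,10) by (simp add: poisson_measure_def poisson_measure_axioms_def usual_filtration_def)
  interpret small_jumps \<nu> k r0
    by standard (use assms in auto)
  from assms(21)[of x] \<open>0 < T\<close> have uF: "u x T \<in> borel_measurable (F T)"
    and "\<exists>\<Phi> Z. (AE (z, s) in compensator \<nu>. 0 < s \<and> s \<le> T \<longrightarrow> \<iota> (\<Phi> (z, s)) = SE (T - s) (B z)) \<and>
      has_compensated_integral P \<nu> \<eta> T \<Phi> Z \<and> (AE \<omega> in P. u x T \<omega> = S T x + Z \<omega>)"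
    unfolding mild_solution_def by auto
  then obtain \<Phi> Z where
    \<Phi>: "AE (z, s) in compensator \<nu>. 0 < s \<and> s \<le> T \<longrightarrow> \<iota> (\<Phi> (z, s)) = SE (T - s) (B z)"
    and Z: "has_compensated_integral P \<nu> \<eta> T \<Phi> Z" and uZ: "AE \<omega> in P. u x T \<omega> = S T x + Z \<omega>"
    by blast
  \<comment> \<open>A box of times just before \<open>T\<close> has positive measure, hence contains
    a point at which the almost everywhere identity holds. Sizes above \<open>r0 / 2\<close> are
    nonzero, so division by \<open>z\<close> yields the statement for \<open>B 1\<close>.\<close>
  have regular: "\<exists>q. 0 < q \<and> q < r \<and> SE q (B 1) \<in> range \<iota>" if r: "0 < r" for r
  proof -
    have "0 < emeasure (compensator \<nu>) ({r0/2<..<r0} \<times> {max 0 (T - r)<..<T})"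
      by (rule box_pos) (use r \<open>0 < T\<close> \<open>0 < r0\<close> in auto)
    from AE_witness_in[OF \<Phi> this] obtain z s where zs: "r0/2 < z" "max 0 (T - r) < s" "s < T"
      and eq: "\<iota> (\<Phi> (z, s)) = SE (T - s) (B z)" by auto
    have z: "z \<noteq> 0" using zs \<open>0 < r0\<close> by auto
    have lin: "linear (SE (T - s))" "linear \<iota>" "linear B"
      using assms zs by (auto simp: extends_semigroup_def extrapolation_space_def bounded_linear.linear)
    have "\<iota> ((1 / z) *\<^sub>R \<Phi> (z, s)) = SE (T - s) (B 1)"
      using z lin linear_scale[of B z 1] by (simp add: linear_scale eq)
    then show ?thesis using zs r by (intro exI[of _ "T - s"]) (auto intro: range_eqI[OF sym])
  qed
  have S: "C0_semigroup S" using assms(1) by (simp add: generates_def)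
  have "control_orbit S lam \<gamma> T \<iota> SE B"
    by (rule control_orbit.intro) (fact S assms regular)+
  moreover have "jump_orbit_axioms \<nu> T \<iota> SE B \<Phi>"
    by (rule jump_orbit_axioms.intro) (fact \<Phi>)
  ultimately interpret jump_orbit \<nu> k r0 S lam \<gamma> T \<iota> SE B \<Phi>
    by (intro jump_orbit.intro small_jumps_axioms)
  obtain E where E: "E \<in> events" "0 < prob E" "AE \<omega> in P. \<omega> \<in> E \<longrightarrow> norm (S T x + Z \<omega>) \<le> \<delta>"
    using compensated_integral_small_ball[OF assms(9) Z \<open>0 < r0\<close> \<delta> jump_sums_dense[OF assms(12)]] by blast
  \<comment> \<open>Measurability of \<open>u x T\<close> passes from \<open>F T\<close> to
    \<open>P\<close>, so that the almost sure inclusion of \<open>E\<close> becomes an inequality of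
    probabilities.\<close>
  have "subalgebra P (F T)" using assms(8) \<open>0 < T\<close> by (auto simp: usual_filtration_def)
  then have "u x T \<in> borel_measurable P" using uF by (rule measurable_from_subalg)
  then have "u x T -` cball 0 \<delta> \<inter> space P \<in> events" by (rule measurable_sets) auto
  moreover have "u x T -` cball 0 \<delta> \<inter> space P = {\<omega> \<in> space P. u x T \<omega> \<in> cball 0 \<delta>}" by auto
  ultimately have "prob E \<le> prob {\<omega> \<in> space P. u x T \<omega> \<in> cball 0 \<delta>}"
  proof (intro finite_measure_mono_AE)
    show "AE \<omega> in P. \<omega> \<in> E \<longrightarrow> \<omega> \<in> {\<omega> \<in> space P. u x T \<omega> \<in> cball 0 \<delta>}"
      using E(3) uZ AE_space by eventually_elim auto
  qed auto
  with E(2) show "\<exists>\<kappa>>0. \<kappa> \<le> prob {\<omega> \<in> space P. u x T \<omega> \<in> cball 0 \<delta>}" by blast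
qed

end
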